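(* Let $\mathcal{G}$ be a connected metric graph with vertex set $\mathsf{V}$, let $\mathsf{v}_0\in\mathsf{V}$, and let $\alpha,\tilde\alpha\in[0,\infty)^{\mathsf{V}}$ be not identically zero with $\tilde\alpha_{\mathsf{v}_0}<\alpha_{\mathsf{v}_0}$ and $\tilde\alpha_{\mathsf{v}}=\alpha_{\mathsf{v}}$ for all $\mathsf{v}\neq\mathsf{v}_0$. Then $T(\mathcal{G},\alpha)<T(\mathcal{G},\tilde\alpha)$.
   Context: A metric graph $\mathcal{G}$ is a finite collection of intervals glued together at their endpoints according to a finite combinatorial graph $(\mathsf{V},\mathsf{E})$ (loops and multiple edges allowed); each edge $\mathsf{e}\in\mathsf{E}$ is identified with $[0,\ell_{\mathsf{e}}]$, $\ell_{\mathsf{e}}\in(0,\infty)$. It is connected if any two points are joined by a continuous path. $\mathsf{E}_{\mathsf{v}}$ is the collection of edges incident to $\mathsf{v}$ (a loop at $\mathsf{v}$ counted twice, once for each endpoint), $u_{\mathsf{e}}$ is the restriction of $u$ to $\mathsf{e}$, and $\frac{\partial u_{\mathsf{e}}}{\partial n}(\mathsf{v})$ is the derivative of $u_{\mathsf{e}}$ at the endpoint $\mathsf{v}$ in the direction pointing into $\mathsf{v}$. For $\alpha\in\mathbb{R}^{\mathsf{V}}$ (the strengths), the operator $-\Delta_{\mathcal{G},\alpha}$ in $L^2(\mathcal{G})$ acts as $u\mapsto -u''$ on each edge, on functions that are edgewise in $H^2(0,\ell_{\mathsf{e}})$, continuous at every vertex, and satisfy $\sum_{\mathsf{e}\in\mathsf{E}_{\mathsf{v}}}\frac{\partial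 u_{\mathsf{e}}}{\partial n}(\mathsf{v})+\alpha_{\mathsf{v}}u(\mathsf{v})=0$ for all $\mathsf{v}\in\mathsf{V}$. The torsion function of $(\mathcal{G},\alpha)$ is the unique solution $\upsilon$ of $-\Delta_{\mathcal{G},\alpha}\upsilon=1$ (it exists and is strictly positive when $\mathcal{G}$ is connected and $\alpha\in[0,\infty)^{\mathsf{V}}$ is not identically zero), and the torsional rigidity is $T(\mathcal{G},\alpha)=\int_{\mathcal{G}}\upsilon(x)\,\mathrm{d}x$. *)

theory Defs
  imports "HOL-Analysis.Analysis" "Graph_Theory.Digraph"
begin

section \<open>Metric graphs\<close>

text \<open>
  The combinatorial graph is a finite multigraph with loops allowed. The orientation of an arc
  only records the identification of the edge \<open>e\<close> with \<open>[0, len e]\<close>: the endpoint \<open>0\<close> is glued to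
  \<open>tail G e\<close>, the endpoint \<open>len e\<close> to \<open>head G e\<close>. Every undirected edge is thus represented by a
  single arc. Vertices arise by gluing endpoints of intervals, so there are no isolated vertices.
\<close>

locale metric_graph = fin_digraph G for G :: "('v, 'e) pre_digraph" +
  fixes len :: "'e \<Rightarrow> real"
  assumes length_pos: "e \<in> arcs G \<Longrightarrow> 0 < len e"
    and verts_are_endpoints: "verts G \<subseteq> tail G ` arcs G \<union> head G ` arcs G"

datatype ('v, 'e) mg_point = Vertex 'v | Interior 'e real

definition glue :: "('v, 'e) pre_digraph \<Rightarrow> ('e \<Rightarrow> real) \<Rightarrow> 'e \<times> real \<Rightarrow> ('v, 'e) mg_point" where
  "glue G len = (\<lambda>(e, x). if x = 0 then Vertex (tail G e)
                        else if x = len e then Vertex (head G e)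
                        else Interior e x)"

definition mg_intervals :: "('v, 'e) pre_digraph \<Rightarrow> ('e \<Rightarrow> real) \<Rightarrow> ('e \<times> real) topology" where
  "mg_intervals G len = sum_topology (\<lambda>e. top_of_set {0..len e}) (arcs G)"

definition mg_points :: "('v, 'e) pre_digraph \<Rightarrow> ('e \<Rightarrow> real) \<Rightarrow> ('v, 'e) mg_point set" where
  "mg_points G len = glue G len ` topspace (mg_intervals G len)"

text \<open>The quotient topology under \<open>glue\<close>; see \<open>quotient_map_glue\<close> below.\<close>

definition mg_topology :: "('v, 'e) pre_digraph \<Rightarrow> ('e \<Rightarrow> real) \<Rightarrow> ('v, 'e) mg_point topology" where
  "mg_topology G len = topology (\<lambda>U. U \<subseteq> mg_points G len \<and>
     openin (mg_intervals G len) {p \<in> topspace (mg_intervals G len). glue G len p \<in> U})"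

lemma openin_mg_topology:
  "openin (mg_topology G len) U \<longleftrightarrow> U \<subseteq> mg_points G len \<and>
     openin (mg_intervals G len) {p \<in> topspace (mg_intervals G len). glue G len p \<in> U}"
proof -
  let ?X = "mg_intervals G len"
  let ?pre = "\<lambda>U. {p \<in> topspace ?X. glue G len p \<in> U}"
  have "istopology (\<lambda>U. U \<subseteq> mg_points G len \<and> openin ?X (?pre U))"
    unfolding istopology_def
  proof (intro conjI allI impI)
    fix S T
    assume "S \<subseteq> mg_points G len \<and> openin ?X (?pre S)" "T \<subseteq> mg_points G len \<and> openin ?X (?pre T)"
    moreover have "?pre (S \<inter> T) = ?pre S \<inter> ?pre T" by auto
    ultimately show "S \<inter> T \<subseteq> mg_points G len" "openin ?X (?pre (S \<inter> T))" by auto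
  next
    fix K
    assume K: "\<forall>S\<in>K. S \<subseteq> mg_points G len \<and> openin ?X (?pre S)"
    then show "\<Union>K \<subseteq> mg_points G len" by auto
    have "?pre (\<Union>K) = \<Union>(?pre ` K)" by auto
    moreover have "openin ?X (\<Union>(?pre ` K))" using K by (intro openin_Union) auto
    ultimately show "openin ?X (?pre (\<Union>K))" by simp
  qed
  then show ?thesis by (simp add: mg_topology_def)
qed

lemma topspace_mg_topology: "topspace (mg_topology G len) = mg_points G len"
proof -
  have "{p \<in> topspace (mg_intervals G len). glue G len p \<in> mg_points G len} = topspace (mg_intervals G len)"
    by (auto simp: mg_points_def)
  then have "openin (mg_topology G len) (mg_points G len)"
    by (simp add: openin_mg_topology)
  then show ?thesis
    by (meson openin_mg_topology openin_subset openin_topspace subset_antisym)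
qed

lemma quotient_map_glue: "quotient_map (mg_intervals G len) (mg_topology G len) (glue G len)"
  by (simp add: quotient_map_def openin_mg_topology topspace_mg_topology mg_points_def)

definition mg_connected :: "('v, 'e) pre_digraph \<Rightarrow> ('e \<Rightarrow> real) \<Rightarrow> bool" where
  "mg_connected G len \<longleftrightarrow> path_connected_space (mg_topology G len)"

definition edge_fun ::
  "('v, 'e) pre_digraph \<Rightarrow> ('e \<Rightarrow> real) \<Rightarrow> (('v, 'e) mg_point \<Rightarrow> real) \<Rightarrow> 'e \<Rightarrow> real \<Rightarrow> real" where
  "edge_fun G len u e = (\<lambda>x. u (glue G len (e, x)))"


section \<open>Sobolev spaces on an interval\<close>

text \<open>Functions here are Borel representatives of classes modulo null sets.\<close>

definition L2_on :: "real \<Rightarrow> real \<Rightarrow> (real \<Rightarrow> real) set" where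
  "L2_on a b = {f. set_borel_measurable lborel {a<..<b} f \<and>
                   set_integrable lborel {a<..<b} (\<lambda>x. (f x)\<^sup>2)}"

definition test_functions :: "real \<Rightarrow> real \<Rightarrow> (real \<Rightarrow> real) set" where
  "test_functions a b = {\<phi>. (\<forall>n x. (deriv ^^ n) \<phi> field_differentiable at x) \<and>
     compact (closure {x. \<phi> x \<noteq> 0}) \<and> closure {x. \<phi> x \<noteq> 0} \<subseteq> {a<..<b}}"

definition weak_deriv :: "real \<Rightarrow> real \<Rightarrow> (real \<Rightarrow> real) \<Rightarrow> (real \<Rightarrow> real) \<Rightarrow> bool" where
  "weak_deriv a b f g \<longleftrightarrow> (\<forall>\<phi>\<in>test_functions a b.
     (LBINT x:{a<..<b}. f x * deriv \<phi> x) = - (LBINT x:{a<..<b}. g x * \<phi> x))"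

definition H2_on :: "real \<Rightarrow> real \<Rightarrow> (real \<Rightarrow> real) set" where
  "H2_on a b = {f \<in> L2_on a b. \<exists>g\<in>L2_on a b. \<exists>h\<in>L2_on a b.
     weak_deriv a b f g \<and> weak_deriv a b g h}"


section \<open>The Laplacian with delta vertex conditions\<close>

text \<open>
  Derivatives at the two ends of \<open>e\<close> in the direction pointing from the edge into the vertex.
  The continuous representative of an \<open>H\<^sup>2\<close> function is continuously differentiable up to the
  boundary, so these one-sided derivatives exist for all functions in the domain below.
\<close>

definition deriv_into_tail ::
  "('v, 'e) pre_digraph \<Rightarrow> ('e \<Rightarrow> real) \<Rightarrow> (('v, 'e) mg_point \<Rightarrow> real) \<Rightarrow> 'e \<Rightarrow> real" where
  "deriv_into_tail G len u e = - vector_derivative (edge_fun G len u e) (at 0 within {0..len e})"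

definition deriv_into_head ::
  "('v, 'e) pre_digraph \<Rightarrow> ('e \<Rightarrow> real) \<Rightarrow> (('v, 'e) mg_point \<Rightarrow> real) \<Rightarrow> 'e \<Rightarrow> real" where
  "deriv_into_head G len u e = vector_derivative (edge_fun G len u e) (at (len e) within {0..len e})"

text \<open>A loop at \<open>v\<close> occurs in both sums, once for each of its endpoints.\<close>

definition sum_normal_derivs ::
  "('v, 'e) pre_digraph \<Rightarrow> ('e \<Rightarrow> real) \<Rightarrow> (('v, 'e) mg_point \<Rightarrow> real) \<Rightarrow> 'v \<Rightarrow> real" where
  "sum_normal_derivs G len u v =
     (\<Sum>e\<in>{e \<in> arcs G. tail G e = v}. deriv_into_tail G len u e) +
     (\<Sum>e\<in>{e \<in> arcs G. head G e = v}. deriv_into_head G len u e)"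

text \<open>
  Elements of the domain are represented by their continuous representatives on the glued space,
  made unique as HOL functions by extensionality. Continuity on the whole graph amounts to
  continuity at the vertices together with the choice of the continuous \<open>H\<^sup>2\<close> representative
  inside each edge.
\<close>

definition delta_domain ::
  "('v, 'e) pre_digraph \<Rightarrow> ('e \<Rightarrow> real) \<Rightarrow> ('v \<Rightarrow> real) \<Rightarrow> (('v, 'e) mg_point \<Rightarrow> real) set" where
  "delta_domain G len \<alpha> = {u \<in> extensional (mg_points G len).
     (\<forall>e\<in>arcs G. edge_fun G len u e \<in> H2_on 0 (len e)) \<and>
     continuous_map (mg_topology G len) euclideanreal u \<and>
     (\<forall>v\<in>verts G. sum_normal_derivs G len u v + \<alpha> v * u (Vertex v) = 0)}"

text \<open>The graph of the operator: \<open>u\<close> lies in its domain and is mapped to the \<open>L\<^sup>2\<close> class of \<open>f\<close>.\<close>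

definition delta_laplacian ::
  "('v, 'e) pre_digraph \<Rightarrow> ('e \<Rightarrow> real) \<Rightarrow> ('v \<Rightarrow> real) \<Rightarrow>
   (('v, 'e) mg_point \<Rightarrow> real) \<Rightarrow> (('v, 'e) mg_point \<Rightarrow> real) \<Rightarrow> bool" where
  "delta_laplacian G len \<alpha> u f \<longleftrightarrow> u \<in> delta_domain G len \<alpha> \<and>
     (\<forall>e\<in>arcs G. edge_fun G len f e \<in> L2_on 0 (len e) \<and>
        (\<exists>g\<in>L2_on 0 (len e). weak_deriv 0 (len e) (edge_fun G len u e) g \<and>
                          weak_deriv 0 (len e) g (\<lambda>x. - edge_fun G len f e x)))"


section \<open>Torsion\<close>

definition torsion_function ::
  "('v, 'e) pre_digraph \<Rightarrow> ('e \<Rightarrow> real) \<Rightarrow> ('v \<Rightarrow> real) \<Rightarrow> ('v, 'e) mg_point \<Rightarrow> real" where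
  "torsion_function G len \<alpha> = (THE u. delta_laplacian G len \<alpha> u (\<lambda>_. 1))"

definition mg_integral ::
  "('v, 'e) pre_digraph \<Rightarrow> ('e \<Rightarrow> real) \<Rightarrow> (('v, 'e) mg_point \<Rightarrow> real) \<Rightarrow> real" where
  "mg_integral G len u = (\<Sum>e\<in>arcs G. LBINT x:{0..len e}. edge_fun G len u e x)"

definition torsional_rigidity ::
  "('v, 'e) pre_digraph \<Rightarrow> ('e \<Rightarrow> real) \<Rightarrow> ('v \<Rightarrow> real) \<Rightarrow> real" where
  "torsional_rigidity G len \<alpha> = mg_integral G len (torsion_function G len \<alpha>)"

end

theory Submission
  imports Defs "Jordan_Normal_Form.Determinant"
begin

text \<open>
  Testing the two weak derivative identities against \<open>\<phi>\<close> and \<open>\<phi>'\<close> shows that \<open>u + x\<^sup>2/2\<close> is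
  orthogonal to all \<open>\<phi>''\<close>, hence affine, so on every edge a torsion function is a parabola
  determined by its two vertex values. The vertex conditions then become a linear system
  \<open>(L + \<alpha>) U = d\<close> on the vertices, where \<open>L\<close> is the Laplacian with edge weights \<open>1/\<ell>\<close> and \<open>d\<close> is half
  the total length of the incident edges; it is uniquely solvable by connectedness, and
  \<open>T = \<Sum> d U + \<Sum> \<ell>\<^sup>3/12\<close>. If \<open>U, U'\<close> solve the systems for \<open>\<alpha>, \<alpha>'\<close>, then symmetry of \<open>L\<close> gives
  \<open>T' - T = (\<alpha> v\<^sub>0 - \<alpha>' v\<^sub>0) U v\<^sub>0 U' v\<^sub>0\<close>, and both solutions are positive by the minimum principle.
\<close>

section \<open>Smooth functions and bumps\<close>

text \<open>Derivatives are witnesses rather than iterates of \<open>deriv\<close>, so that closure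
  proofs can supply a formula and recurse on it.\<close>

primrec n_times_differentiable :: "nat \<Rightarrow> (real \<Rightarrow> real) \<Rightarrow> bool" where
  "n_times_differentiable 0 f \<longleftrightarrow> True"
| "n_times_differentiable (Suc n) f \<longleftrightarrow>
     (\<exists>f'. (\<forall>x. (f has_real_derivative f' x) (at x)) \<and> n_times_differentiable n f')"

definition smooth :: "(real \<Rightarrow> real) \<Rightarrow> bool" where
  "smooth f \<longleftrightarrow> (\<forall>n. n_times_differentiable n f)"

lemma n_times_differentiable_SucI:
  "(\<And>x. (f has_real_derivative f' x) (at x)) \<Longrightarrow> n_times_differentiable n f' \<Longrightarrow>
   n_times_differentiable (Suc n) f"
  by auto

lemma n_times_differentiable_SucD:
  "n_times_differentiable (Suc n) f \<Longrightarrow> n_times_differentiable n f"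
  by (induction n arbitrary: f) auto

lemma n_times_differentiable_const: "n_times_differentiable n (\<lambda>x. c)"
proof (induction n arbitrary: c)
  case (Suc n)
  show ?case
    by (rule n_times_differentiable_SucI[of _ "\<lambda>x. 0"]) (use Suc in auto)
qed simp

lemma n_times_differentiable_add:
  "n_times_differentiable n f \<Longrightarrow> n_times_differentiable n g \<Longrightarrow>
   n_times_differentiable n (\<lambda>x. f x + g x)"
proof (induction n arbitrary: f g)
  case (Suc n)
  obtain f' g' where *: "\<forall>x. (f has_real_derivative f' x) (at x)" "n_times_differentiable n f'"
     "\<forall>x. (g has_real_derivative g' x) (at x)" "n_times_differentiable n g'"
    using Suc.prems by auto
  show ?case
    by (rule n_times_differentiable_SucI[of _ "\<lambda>x. f' x + g' x"])
      (use * in \<open>simp_all add: Suc.IH DERIV_add\<close>)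
qed simp

lemma n_times_differentiable_mult:
  "n_times_differentiable n f \<Longrightarrow> n_times_differentiable n g \<Longrightarrow>
   n_times_differentiable n (\<lambda>x. f x * g x)"
proof (induction n arbitrary: f g)
  case (Suc n)
  obtain f' g' where *: "\<forall>x. (f has_real_derivative f' x) (at x)" "n_times_differentiable n f'"
     "\<forall>x. (g has_real_derivative g' x) (at x)" "n_times_differentiable n g'"
    using Suc.prems by auto
  \<comment> \<open>Each summand of the product rule keeps one factor undifferentiated, hence the
    use of \<open>n_times_differentiable_SucD\<close>.\<close>
  have "n_times_differentiable n (\<lambda>x. f' x * g x + f x * g' x)"
    using * Suc.prems[THEN n_times_differentiable_SucD]
    by (intro n_times_differentiable_add Suc.IH)
  moreover have "((\<lambda>x. f x * g x) has_real_derivative f' x * g x + f x * g' x) (at x)" for x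
    using DERIV_mult[of f "f' x" x UNIV g "g' x"] * by (simp add: mult.commute)
  ultimately show ?case by (rule n_times_differentiable_SucI[rotated])
qed simp

lemma n_times_differentiable_affine:
  "n_times_differentiable n f \<Longrightarrow> n_times_differentiable n (\<lambda>x. f (a + b * x))"
proof (induction n arbitrary: f)
  case (Suc n)
  obtain f' where *: "\<forall>x. (f has_real_derivative f' x) (at x)" "n_times_differentiable n f'"
    using Suc.prems by auto
  have "((\<lambda>x. f (a + b * x)) has_real_derivative b * f' (a + b * x)) (at x)" for x
  proof -
    have "((\<lambda>x. a + b * x) has_real_derivative 0 + b) (at x)"
      by (intro DERIV_add DERIV_const DERIV_cmult_Id)
    then show ?thesis
      using DERIV_chain2[of f "f' (a + b * x)" "\<lambda>x. a + b * x" x b UNIV] *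
      by (simp add: mult.commute[of _ b])
  qed
  then show ?case
    by (rule n_times_differentiable_SucI)
      (rule n_times_differentiable_mult[OF n_times_differentiable_const Suc.IH[OF *(2)]])
qed simp

lemma smooth_const: "smooth (\<lambda>x. c)"
  and smooth_add: "smooth f \<Longrightarrow> smooth g \<Longrightarrow> smooth (\<lambda>x. f x + g x)"
  and smooth_mult: "smooth f \<Longrightarrow> smooth g \<Longrightarrow> smooth (\<lambda>x. f x * g x)"
  and smooth_affine: "smooth f \<Longrightarrow> smooth (\<lambda>x. f (a + b * x))"
  by (auto simp: smooth_def n_times_differentiable_const n_times_differentiable_add
      n_times_differentiable_mult n_times_differentiable_affine)

lemma smooth_if_derivative:
  assumes "\<And>x. (f has_real_derivative f' x) (at x)" "smooth f'"
  shows "smooth f"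
  unfolding smooth_def
proof
  fix n show "n_times_differentiable n f"
    using assms by (cases n) (auto simp: smooth_def)
qed

lemma smooth_deriv: "smooth f \<Longrightarrow> smooth (deriv f)"
  unfolding smooth_def
proof
  fix n assume "\<forall>n. n_times_differentiable n f"
  then have "n_times_differentiable (Suc n) f" by blast
  then obtain f' where "\<forall>x. (f has_real_derivative f' x) (at x)" "n_times_differentiable n f'"
    by auto
  moreover from this have "deriv f = f'" by (auto intro: DERIV_imp_deriv)
  ultimately show "n_times_differentiable n (deriv f)" by simp
qed

lemma smooth_field_differentiable: "smooth f \<Longrightarrow> f field_differentiable at x"
  unfolding smooth_def field_differentiable_def by (metis n_times_differentiable.simps(2))

text \<open>Matches the form in which \<open>test_functions\<close> demands smoothness.\<close>

lemma smooth_iterated_deriv_differentiable: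
  assumes "smooth f"
  shows "(deriv ^^ n) f field_differentiable at x"
proof -
  have "smooth ((deriv ^^ n) f)" by (induction n) (auto simp: assms smooth_deriv)
  then show ?thesis by (rule smooth_field_differentiable)
qed

lemma smooth_continuous_on: "smooth f \<Longrightarrow> continuous_on A f"
  by (meson continuous_at_imp_continuous_on field_differentiable_imp_continuous_at
      smooth_field_differentiable)

section \<open>Flat functions and compactly supported bumps\<close>

text \<open>The polynomial factor makes the family closed under differentiation, so that smoothness
  becomes an induction over all \<open>p\<close> at once.\<close>

definition flat_fun :: "real poly \<Rightarrow> real \<Rightarrow> real" where
  "flat_fun p x = (if 0 < x then poly p (1 / x) * exp (- (1 / x)) else 0)"

lemma poly_times_exp_neg_tendsto_0: "((\<lambda>t::real. poly p t * exp (- t)) \<longlongrightarrow> 0) at_top"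
proof -
  have "((\<lambda>t::real. \<Sum>i\<le>degree p. coeff p i * (t ^ i / exp t)) \<longlongrightarrow> (\<Sum>i\<le>degree p. coeff p i * 0)) at_top"
    by (intro tendsto_intros tendsto_power_div_exp_0)
  then show ?thesis
    by (simp add: poly_altdef exp_minus sum_distrib_right divide_inverse mult.assoc)
qed

text \<open>With t = 1/x and dt/dx = -t^2, differentiating p(t) exp(-t) gives t^2 (p - p')(t)
  exp(-t). At the origin the right-hand difference quotient tends to 0 because exponential decay
  beats every polynomial.\<close>

lemma flat_fun_has_derivative:
  "(flat_fun p has_real_derivative flat_fun ([:0, 0, 1:] * (p - pderiv p)) x) (at x)"
proof -
  consider "x < 0" | "x > 0" | "x = 0" by linarith
  then show ?thesis
  proof cases
    case 1
    have "((\<lambda>x. 0) has_real_derivative 0) (at x)" by simp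
    moreover have "eventually (\<lambda>y. y < 0) (nhds x)"
      using 1 by (intro eventually_nhds_in_open[of "{..<0}", simplified]) auto
    then have "eventually (\<lambda>y. flat_fun p y = 0) (nhds x)"
      by eventually_elim (auto simp: flat_fun_def)
    ultimately show ?thesis
      using 1 by (subst DERIV_cong_ev[OF refl _ refl]) (auto simp: flat_fun_def)
  next
    case 2
    have inv: "((\<lambda>x. 1 / x) has_real_derivative - (1 / x\<^sup>2)) (at x)"
      using 2 by (auto intro!: derivative_eq_intros simp: power2_eq_square)
    have "((\<lambda>x. poly p (1 / x) * exp (- (1 / x))) has_real_derivative
       poly (pderiv p) (1 / x) * (- (1 / x\<^sup>2)) * exp (- (1 / x)) +
       exp (- (1 / x)) * (- (- (1 / x\<^sup>2))) * poly p (1 / x)) (at x)"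
      by (intro DERIV_mult DERIV_chain2[OF poly_DERIV inv] DERIV_chain2[OF DERIV_exp] DERIV_minus inv)
    then have "((\<lambda>x. poly p (1 / x) * exp (- (1 / x))) has_real_derivative
       flat_fun ([:0, 0, 1:] * (p - pderiv p)) x) (at x)"
      using 2 by (simp add: flat_fun_def algebra_simps power2_eq_square)
    moreover have "eventually (\<lambda>y. y > 0) (nhds x)"
      using 2 by (intro eventually_nhds_in_open[of "{0<..}", simplified]) auto
    then have "eventually (\<lambda>y. flat_fun p y = poly p (1 / y) * exp (- (1 / y))) (nhds x)"
      by eventually_elim (auto simp: flat_fun_def)
    ultimately show ?thesis
      by (subst DERIV_cong_ev[OF refl _ refl]) auto
  next
    case 3
    \<comment> \<open>With t = 1/h, dividing by h multiplies by t, which is the extra factor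
      \<open>[:0,1:]\<close>.\<close>
    have "((\<lambda>h. poly ([:0,1:] * p) (inverse h) * exp (- inverse h)) \<longlongrightarrow> 0) (at_right 0)"
      by (rule filterlim_compose[OF poly_times_exp_neg_tendsto_0 filterlim_inverse_at_top_right])
    moreover have "eventually (\<lambda>h::real. h > 0) (at_right 0)"
      by (simp add: eventually_at_right_less)
    then have "eventually (\<lambda>h. poly ([:0,1:] * p) (inverse h) * exp (- inverse h)
       = flat_fun p h / h) (at_right 0)"
      by eventually_elim (auto simp: flat_fun_def field_simps)
    ultimately have "((\<lambda>h. flat_fun p h / h) \<longlongrightarrow> 0) (at_right 0)"
      by (blast intro: Lim_transform_eventually)
    moreover have "eventually (\<lambda>h::real. h < 0) (at_left 0)"
      by (simp add: eventually_at_filter)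
    then have "eventually (\<lambda>h. flat_fun p h / h = 0) (at_left 0)"
      by eventually_elim (auto simp: flat_fun_def)
    then have "((\<lambda>h. flat_fun p h / h) \<longlongrightarrow> 0) (at_left 0)"
      by (rule tendsto_eventually)
    ultimately have "((\<lambda>h. flat_fun p h / h) \<longlongrightarrow> 0) (at 0)"
      by (rule filterlim_split_at_real[rotated])
    then show ?thesis using 3 by (simp add: DERIV_def flat_fun_def)
  qed
qed

lemma smooth_flat_fun: "smooth (flat_fun p)"
proof -
  have "n_times_differentiable n (flat_fun p)" for n
  proof (induction n arbitrary: p)
    case (Suc n)
    show ?case by (rule n_times_differentiable_SucI[OF flat_fun_has_derivative Suc])
  qed simp
  then show ?thesis by (simp add: smooth_def)
qed

lemma zero_derivative_eq:
  assumes "\<And>x. (f has_real_derivative f' x) (at x)" "a \<le> b" "\<And>x. a \<le> x \<Longrightarrow> x \<le> b \<Longrightarrow> f' x = 0"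
  shows "f a = f b"
proof (cases "a = b")
  case False
  then obtain z where "a < z" "z < b" "f b - f a = (b - a) * f' z"
    using MVT2[of a b f f'] assms(1,2) by auto
  then show ?thesis using assms(3)[of z] by simp
qed simp

text \<open>\<eta> is a building block for second derivatives of test functions. Its second
  antiderivative \<open>K\<close> need not have compact support, but it is zero on the left and
  affine on the right, so suitable combinations of translates do.\<close>

lemma ex_bump:
  assumes "\<epsilon> > 0"
  obtains \<eta> H K :: "real \<Rightarrow> real" and c k :: real where
    "smooth \<eta>" "\<And>x. (H has_real_derivative \<eta> x) (at x)" "\<And>x. (K has_real_derivative H x) (at x)"
    "\<And>x. 0 \<le> \<eta> x" "0 < \<eta> 0" "\<And>x. \<epsilon> \<le> \<bar>x\<bar> \<Longrightarrow> \<eta> x = 0"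
    "\<And>x. x \<le> - \<epsilon> \<Longrightarrow> H x = 0" "\<And>x. x \<le> - \<epsilon> \<Longrightarrow> K x = 0"
    "\<And>x. \<epsilon> \<le> x \<Longrightarrow> H x = c" "\<And>x. \<epsilon> \<le> x \<Longrightarrow> K x = c * x + k"
proof -
  \<comment> \<open>Normalising at -\<epsilon> is what makes \<open>H\<close> and \<open>K\<close>
    vanish to the left of the support.\<close>
  have antideriv: "\<exists>F. F (- \<epsilon>) = 0 \<and> (\<forall>x. (F has_real_derivative f x) (at x))"
    if "\<And>x. isCont f x" for f :: "real \<Rightarrow> real"
  proof -
    have "\<exists>F. \<forall>x. - \<infinity> < ereal x \<longrightarrow> ereal x < \<infinity> \<longrightarrow> (F has_vector_derivative f x) (at x)"
      by (rule einterval_antiderivative[of "-\<infinity>" "\<infinity>" f]) (simp_all add: that)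
    then obtain F where "\<forall>x. - \<infinity> < ereal x \<longrightarrow> ereal x < \<infinity> \<longrightarrow> (F has_vector_derivative f x) (at x)"
      by (rule exE)
    then have F: "(F has_real_derivative f x) (at x)" for x
      by (simp add: has_real_derivative_iff_has_vector_derivative)
    have "((\<lambda>x. F x - F (- \<epsilon>)) has_real_derivative f x) (at x)" for x
      using DERIV_diff[OF F DERIV_const, of "F (- \<epsilon>)" x] by (simp only: diff_zero)
    then have "\<forall>x. ((\<lambda>x. F x - F (- \<epsilon>)) has_real_derivative f x) (at x)" by (rule allI)
    then show ?thesis
      by (intro exI[where x = "\<lambda>x. F x - F (- \<epsilon>)"]) simp
  qed
  \<comment> \<open>The factors vanish for x \<le> -\<epsilon> and for x \<ge> \<epsilon>
    respectively; \<open>1 *\<close> and \<open>(-1) *\<close> fit the form of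
    \<open>smooth_affine\<close>.\<close>
  define \<eta> where "\<eta> x = flat_fun 1 (\<epsilon> + 1 * x) * flat_fun 1 (\<epsilon> + (-1) * x)" for x
  have \<eta>: "smooth \<eta>" unfolding \<eta>_def
    by (rule smooth_mult[OF smooth_affine[OF smooth_flat_fun] smooth_affine[OF smooth_flat_fun]])
  then have "isCont \<eta> x" for x
    using smooth_continuous_on[of \<eta> UNIV] by (simp add: continuous_on_eq_continuous_at)
  from antideriv[OF this]
  obtain H where "H (- \<epsilon>) = 0 \<and> (\<forall>x. (H has_real_derivative \<eta> x) (at x))"
    by (rule exE)
  then have H: "H (- \<epsilon>) = 0" "\<And>x. (H has_real_derivative \<eta> x) (at x)" by simp_all
  from H(2) have "isCont H x" for x by (rule DERIV_isCont)
  from antideriv[OF this]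
  obtain K where "K (- \<epsilon>) = 0 \<and> (\<forall>x. (K has_real_derivative H x) (at x))"
    by (rule exE)
  then have K: "K (- \<epsilon>) = 0" "\<And>x. (K has_real_derivative H x) (at x)" by simp_all
  have \<eta>0: "\<eta> x = 0" if "\<epsilon> \<le> \<bar>x\<bar>" for x
    using that by (auto simp: \<eta>_def flat_fun_def)
  have H0: "H x = 0" if "x \<le> -\<epsilon>" for x
    using zero_derivative_eq[of H \<eta> x "-\<epsilon>", OF H(2) that] \<eta>0 assms H(1) by simp
  have Hc: "H x = H \<epsilon>" if "\<epsilon> \<le> x" for x
    using zero_derivative_eq[of H \<eta> \<epsilon> x, OF H(2) that] \<eta>0 assms by simp
  have K0: "K x = 0" if "x \<le> -\<epsilon>" for x
    using zero_derivative_eq[of K H x "-\<epsilon>", OF K(2) that] H0 K(1) by simp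
  \<comment> \<open>Subtracting the final slope leaves a derivative that is zero from \<epsilon>
    onwards.\<close>
  have "((\<lambda>x. K x - H \<epsilon> * x) has_real_derivative H x - H \<epsilon>) (at x)" for x
    by (intro DERIV_diff K DERIV_cmult_Id)
  note affine = zero_derivative_eq[where f = "\<lambda>x. K x - H \<epsilon> * x" and f' = "\<lambda>x. H x - H \<epsilon>", OF this]
  have Kc: "K x = H \<epsilon> * x + (K \<epsilon> - H \<epsilon> * \<epsilon>)" if "\<epsilon> \<le> x" for x
  proof -
    have "H y - H \<epsilon> = 0" if "\<epsilon> \<le> y" for y using Hc[OF that] by simp
    from affine[OF that this] show ?thesis by linarith
  qed
  have "0 \<le> flat_fun 1 x" for x by (simp add: flat_fun_def)
  then have pos: "0 \<le> \<eta> x" "0 < \<eta> 0" for x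
    using assms by (simp_all add: \<eta>_def flat_fun_def[of _ \<epsilon>])
  show thesis
    by (rule that[OF \<eta> H(2) K(2) pos \<eta>0 H0 K0 Hc Kc])
qed


section \<open>Weak derivatives on an interval\<close>

lemma set_integrable_Ioo_continuous:
  fixes f :: "real \<Rightarrow> real"
  assumes "continuous_on {a..b} f"
  shows "set_integrable lborel {a<..<b} f"
  by (rule set_integrable_subset[OF borel_integrable_atLeastAtMost'[OF assms]]) auto

lemma LBINT_Ioo_FTC:
  fixes f F :: "real \<Rightarrow> real"
  assumes "a \<le> b" "continuous_on {a..b} f" "\<And>x. (F has_real_derivative f x) (at x)"
  shows "(LBINT x:{a<..<b}. f x) = F b - F a"
proof -
  have "(LBINT x=a..b. f x) = F b - F a"
    by (rule interval_integral_FTC_finite)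
      (use assms in \<open>simp_all add: has_field_derivative_at_within
        flip: has_real_derivative_iff_has_vector_derivative\<close>)
  then show ?thesis using assms(1) by (simp add: interval_integral_Ioo)
qed

lemma integrable_continuous_compact_support:
  fixes f :: "real \<Rightarrow> real"
  assumes "continuous_on UNIV f" "\<And>x. x \<notin> {a..b} \<Longrightarrow> f x = 0"
  shows "integrable lborel f"
proof -
  have "set_integrable lborel {a..b} f"
    by (rule borel_integrable_atLeastAtMost') (rule continuous_on_subset[OF assms(1)], simp)
  moreover have "(\<lambda>x. indicator {a..b} x *\<^sub>R f x) = f"
    using assms(2) by (force simp: indicator_def)
  ultimately show ?thesis by (simp add: set_integrable_def)
qed

text \<open>Continuity keeps the sign of \<open>D\<close> constant near 0, so a nonnegative bump
  supported there cannot average it to zero. \<delta> depends on \<open>D\<close> only, so the bump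
  can be chosen afterwards.\<close>

lemma bump_integral_nonzero:
  fixes D :: "real \<Rightarrow> real"
  assumes D: "continuous_on UNIV D" "D 0 \<noteq> 0"
  obtains \<delta> where "0 < \<delta>"
    "\<And>\<epsilon> \<eta>. 0 < \<epsilon> \<Longrightarrow> \<epsilon> < \<delta> \<Longrightarrow> continuous_on UNIV \<eta> \<Longrightarrow> (\<And>x. 0 \<le> \<eta> x) \<Longrightarrow> 0 < \<eta> 0 \<Longrightarrow>
      (\<And>x. \<epsilon> \<le> \<bar>x\<bar> \<Longrightarrow> \<eta> x = 0) \<Longrightarrow> (\<integral>x. D x * \<eta> x \<partial>lborel) \<noteq> 0"
proof -
  have "isCont D 0" using D(1) by (simp add: continuous_on_eq_continuous_at)
  then obtain \<delta> where \<delta>: "0 < \<delta>" "\<And>x. \<bar>x\<bar> < \<delta> \<Longrightarrow> \<bar>D x - D 0\<bar> < \<bar>D 0\<bar>"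
    using D(2) unfolding continuous_at_eps_delta dist_real_def
    by (metis diff_zero zero_less_abs_iff)
  show thesis
  proof (rule that[OF \<delta>(1)])
    fix \<epsilon> and \<eta> :: "real \<Rightarrow> real"
    assume \<epsilon>: "0 < \<epsilon>" "\<epsilon> < \<delta>" and \<eta>: "continuous_on UNIV \<eta>" "\<And>x. 0 \<le> \<eta> x" "0 < \<eta> 0"
      and supp: "\<And>x. \<epsilon> \<le> \<bar>x\<bar> \<Longrightarrow> \<eta> x = 0"
    \<comment> \<open>The factor \<open>sgn (D 0)\<close> treats both signs of \<open>D\<close> at
      once.\<close>
    define g where "g x = D x * \<eta> x * sgn (D 0)" for x
    have g: "continuous_on UNIV g"
      unfolding g_def by (intro continuous_intros D \<eta>)
    have g_supp: "g x = 0" if "x \<notin> {- \<epsilon>..\<epsilon>}" for x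
      using that supp[of x] by (auto simp: g_def)
    have g_nonneg: "0 \<le> g x" for x
    proof (cases "\<bar>x\<bar> < \<delta>")
      case True
      then have "0 \<le> D x * sgn (D 0)" using \<delta>(2)[of x] by (auto simp: sgn_if)
      from mult_nonneg_nonneg[OF this \<eta>(2)[of x]] show ?thesis by (simp add: g_def ac_simps)
    qed (use supp[of x] \<epsilon> in \<open>simp add: g_def\<close>)
    show "(\<integral>x. D x * \<eta> x \<partial>lborel) \<noteq> 0"
    proof
      assume "(\<integral>x. D x * \<eta> x \<partial>lborel) = 0"
      then have "(\<integral>x. g x \<partial>lborel) = 0" unfolding g_def by simp
      then have "(g has_integral 0) UNIV"
        using has_integral_integral_lborel[OF integrable_continuous_compact_support[OF g g_supp]]
        by simp
      \<comment> \<open>A nonnegative continuous function with integral zero over a compact interval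
        vanishes there; restricting to the support brings \<open>g\<close> into that form.\<close>
      moreover have "g = (\<lambda>x. if x \<in> {- \<epsilon>..\<epsilon>} then g x else 0)"
        using g_supp by force
      ultimately have "(g has_integral 0) {- \<epsilon>..\<epsilon>}"
        by (metis has_integral_restrict_UNIV)
      then have "g 0 = 0"
        using has_integral_0_cbox_imp_0[of "-\<epsilon>" \<epsilon> g 0] \<epsilon> g_nonneg continuous_on_subset[OF g]
        by simp
      then show False using D(2) \<eta>(3) by (simp add: g_def sgn_zero_iff)
    qed
  qed
qed

lemma derivative_zero_outside_support:
  assumes "(\<phi> has_real_derivative D) (at x)" "\<And>x. x \<notin> {c..d} \<Longrightarrow> \<phi> x = 0" "x \<notin> {c..d}"
  shows "D = 0"
proof -
  have "open (- {c..d})" by auto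
  moreover have "x \<in> - {c..d}" using assms(3) by simp
  ultimately have "((\<lambda>_. 0) has_real_derivative D) (at x)"
    by (rule has_field_derivative_transform_within_open[OF assms(1)]) (use assms(2) in simp)
  then show ?thesis using DERIV_const DERIV_unique by blast
qed

lemma test_functionI:
  assumes "smooth \<phi>" "a < c" "d < b" "\<And>x. x \<notin> {c..d} \<Longrightarrow> \<phi> x = 0"
  shows "\<phi> \<in> test_functions a b"
proof -
  have sub: "closure {x. \<phi> x \<noteq> 0} \<subseteq> {c..d}"
    by (rule closure_minimal) (use assms(4) in force)+
  moreover have "bounded (closure {x. \<phi> x \<noteq> 0})"
    using sub bounded_subset bounded_closed_interval by blast
  then have "compact (closure {x. \<phi> x \<noteq> 0})" by (simp add: compact_eq_bounded_closed)
  ultimately show ?thesis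
    using assms(1-3) smooth_iterated_deriv_differentiable by (force simp: test_functions_def)
qed

section \<open>Orthogonality to second derivatives of test functions\<close>

text \<open>A second-order du Bois-Reymond lemma. If affinity failed at a convex combination m of
  interior points p < q, the corresponding combination of bumps at p, m and q would be the second
  derivative of a test function with nonzero integral against \<open>w\<close>.\<close>

lemma affine_if_orthogonal_to_second_derivatives:
  fixes w :: "real \<Rightarrow> real"
  assumes "0 < l" and w: "continuous_on {0..l} w"
    and orth: "\<And>\<phi> \<phi>' \<phi>'' c d. smooth \<phi>'' \<Longrightarrow> (\<And>x. (\<phi> has_real_derivative \<phi>' x) (at x)) \<Longrightarrow>
      (\<And>x. (\<phi>' has_real_derivative \<phi>'' x) (at x)) \<Longrightarrow> 0 < c \<Longrightarrow> d < l \<Longrightarrow>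
      (\<And>x. x \<notin> {c..d} \<Longrightarrow> \<phi> x = 0) \<Longrightarrow> (LBINT x:{0<..<l}. w x * \<phi>'' x) = 0"
    and x: "x \<in> {0..l}"
  shows "w x = w 0 + (w l - w 0) * x / l"
proof -
  \<comment> \<open>Constant extension beyond the interval gives a globally continuous function that
    can be translated freely.\<close>
  define W where "W x = w (max 0 (min x l))" for x
  have W: "continuous_on A W" for A
    unfolding W_def using \<open>0 < l\<close>
    by (intro continuous_on_compose2[OF w]) (auto intro!: continuous_intros)
  have interior: "W (\<theta> * p + (1 - \<theta>) * q) = \<theta> * W p + (1 - \<theta>) * W q"
    if pq: "0 < p" "p < q" "q < l" and \<theta>: "0 \<le> \<theta>" "\<theta> \<le> 1" for p q \<theta>
  proof (rule ccontr)
    assume neq: "\<not> ?thesis"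
    define m where "m = \<theta> * p + (1 - \<theta>) * q"
    have m: "p \<le> m" "m \<le> q"
      using pq \<theta> mult_left_mono[of p q \<theta>] mult_left_mono[of p q "1 - \<theta>"]
      by (auto simp: m_def algebra_simps)
    \<comment> \<open>The defect of affinity with all three points shifted by s; at s = 0 it is the
      assumed nonzero defect.\<close>
    define D where "D s = \<theta> * W (p + s) - W (m + s) + (1 - \<theta>) * W (q + s)" for s
    have cont_shift: "continuous_on UNIV (\<lambda>s. W (r + s))" for r
      by (intro continuous_on_compose2[OF W[of UNIV]]) (auto intro!: continuous_intros)
    have "continuous_on UNIV D" "D 0 \<noteq> 0"
      unfolding D_def using neq by (auto intro!: continuous_intros cont_shift simp: m_def)
    then obtain \<delta> where \<delta>: "0 < \<delta>"
      "\<And>\<epsilon> \<eta>. 0 < \<epsilon> \<Longrightarrow> \<epsilon> < \<delta> \<Longrightarrow> continuous_on UNIV \<eta> \<Longrightarrow> (\<And>x. 0 \<le> \<eta> x) \<Longrightarrow> 0 < \<eta> 0 \<Longrightarrow>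
        (\<And>x. \<epsilon> \<le> \<bar>x\<bar> \<Longrightarrow> \<eta> x = 0) \<Longrightarrow> (\<integral>x. D x * \<eta> x \<partial>lborel) \<noteq> 0"
      by (rule bump_integral_nonzero) simp
    \<comment> \<open>Below \<delta> for the nonvanishing integral, below p and l - q to keep the
      translated supports inside the open interval.\<close>
    define \<epsilon> where "\<epsilon> = min (\<delta> / 2) (min (p / 2) ((l - q) / 2))"
    have \<epsilon>: "0 < \<epsilon>" "\<epsilon> < \<delta>" "\<epsilon> < p" "q + \<epsilon> < l"
      using \<delta>(1) pq by (auto simp: \<epsilon>_def min_def field_simps)
    obtain \<eta> H K c k where bump:
      "smooth \<eta>" "\<And>x. (H has_real_derivative \<eta> x) (at x)" "\<And>x. (K has_real_derivative H x) (at x)"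
      "\<And>x. 0 \<le> \<eta> x" "0 < \<eta> 0" "\<And>x. \<epsilon> \<le> \<bar>x\<bar> \<Longrightarrow> \<eta> x = 0"
      "\<And>x. x \<le> - \<epsilon> \<Longrightarrow> H x = 0" "\<And>x. x \<le> - \<epsilon> \<Longrightarrow> K x = 0"
      "\<And>x. \<epsilon> \<le> x \<Longrightarrow> H x = c" "\<And>x. \<epsilon> \<le> x \<Longrightarrow> K x = c * x + k"
      by (rule ex_bump[OF \<epsilon>(1)]) (rule that)
    \<comment> \<open>\<open>comb K\<close> is a test function: the affine parts of the three translates of \<open>K\<close> cancel to the
      right of their supports because \<open>m\<close> is the convex combination of \<open>p\<close> and \<open>q\<close>.\<close>
    define comb where "comb f x = \<theta> * f (- p + 1 * x) + ((-1) * f (- m + 1 * x) + (1 - \<theta>) * f (- q + 1 * x))"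
      for f :: "real \<Rightarrow> real" and x
    have comb_deriv: "(comb f has_real_derivative comb f' x) (at x)"
      if "\<And>x. (f has_real_derivative f' x) (at x)" for f f' x
    proof -
      have sh: "((\<lambda>x. f (r + 1 * x)) has_real_derivative f' (r + 1 * x)) (at x)" for r
        using DERIV_shift[of f "f' (x + r)" x r] that[of "x + r"] by (simp add: add.commute)
      show ?thesis unfolding comb_def[abs_def]
        by (intro DERIV_add DERIV_cmult sh)
    qed
    have "smooth (comb \<eta>)"
      unfolding comb_def[abs_def]
      by (intro smooth_add smooth_mult[OF smooth_const] smooth_affine[OF bump(1)])
    moreover have "comb K x = 0" if "x \<notin> {p - \<epsilon>..q + \<epsilon>}" for x
    proof -
      from that have "x \<le> p - \<epsilon> \<or> q + \<epsilon> \<le> x" by auto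
      then show ?thesis
      proof
        assume "x \<le> p - \<epsilon>"
        then show ?thesis using m pq by (simp add: comb_def bump(8))
      next
        assume "q + \<epsilon> \<le> x"
        then have "comb K x = \<theta> * (c * (x - p) + k) - (c * (x - m) + k) + (1 - \<theta>) * (c * (x - q) + k)"
          using m pq by (simp add: comb_def bump(10))
        then show ?thesis by (simp add: m_def algebra_simps)
      qed
    qed
    ultimately have "(LBINT x:{0<..<l}. w x * comb \<eta> x) = 0"
      using \<epsilon> by (intro orth[OF _ comb_deriv[OF bump(3)] comb_deriv[OF bump(2)], of "p - \<epsilon>" "q + \<epsilon>"]) auto
    \<comment> \<open>\<open>comb \<eta>\<close> vanishes outside the interval, so the integral
      extends to the whole line, where translation is available.\<close>
    moreover have eq: "indicator {0<..<l} x *\<^sub>R (w x * comb \<eta> x) = W x * comb \<eta> x" for x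
    proof (cases "0 < x \<and> x < l")
      case False
      then have "comb \<eta> x = 0" using \<epsilon> pq m by (auto simp: comb_def bump(6))
      then show ?thesis by simp
    qed (simp add: W_def)
    ultimately have zero: "(\<integral>x. W x * comb \<eta> x \<partial>lborel) = 0"
      by (simp only: set_lebesgue_integral_def eq)
    have \<eta>: "continuous_on A \<eta>" for A using smooth_continuous_on[OF bump(1)] .
    have int: "integrable lborel (\<lambda>s. W (r + s) * \<eta> s)" for r
      by (rule integrable_continuous_compact_support[of _ "-\<epsilon>" \<epsilon>])
        (use bump(6) in \<open>auto intro!: continuous_intros cont_shift \<eta>\<close>)
    \<comment> \<open>Translation invariance moves the shifts between \<eta> and \<open>W\<close>:
      the integral of \<open>comb \<eta>\<close> against \<open>W\<close> becomes that of \<eta>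
      against \<open>D\<close>.\<close>
    have int': "integrable lborel (\<lambda>x. W x * \<eta> (- r + 1 * x))"
      and shift: "(\<integral>x. W x * \<eta> (- r + 1 * x) \<partial>lborel) = (\<integral>s. W (r + s) * \<eta> s \<partial>lborel)" for r
      using lborel_integrable_real_affine_iff[of 1 "\<lambda>x. W x * \<eta> (- r + 1 * x)" r] int[of r]
        lborel_integral_real_affine[of 1 "\<lambda>x. W x * \<eta> (- r + 1 * x)" r]
      by simp_all
    have "(\<integral>x. D x * \<eta> x \<partial>lborel) = (\<integral>x. \<theta> * (W (p + x) * \<eta> x) +
        ((-1) * (W (m + x) * \<eta> x) + (1 - \<theta>) * (W (q + x) * \<eta> x)) \<partial>lborel)"
      by (simp add: D_def algebra_simps)
    also have "\<dots> = \<theta> * (\<integral>x. W (p + x) * \<eta> x \<partial>lborel) +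
        ((-1) * (\<integral>x. W (m + x) * \<eta> x \<partial>lborel) + (1 - \<theta>) * (\<integral>x. W (q + x) * \<eta> x \<partial>lborel))"
      by (simp only: Bochner_Integration.integral_add Bochner_Integration.integrable_add
          integrable_mult_right integral_mult_right_zero int)
    also have "\<dots> = (\<integral>x. \<theta> * (W x * \<eta> (- p + 1 * x)) +
        ((-1) * (W x * \<eta> (- m + 1 * x)) + (1 - \<theta>) * (W x * \<eta> (- q + 1 * x))) \<partial>lborel)"
      by (simp only: Bochner_Integration.integral_add Bochner_Integration.integrable_add
          integrable_mult_right integral_mult_right_zero int' shift)
    also have "\<dots> = (\<integral>x. W x * comb \<eta> x \<partial>lborel)"
      by (simp add: comb_def algebra_simps)
    finally show False using zero \<delta>(2)[OF \<epsilon>(1,2) \<eta> bump(4,5,6)] by simp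
  qed
  \<comment> \<open>Test functions only see interior points; the endpoints are reached by continuity.\<close>
  have closed: "W (\<theta> * 0 + (1 - \<theta>) * l) = \<theta> * W 0 + (1 - \<theta>) * W l"
    if \<theta>: "0 \<le> \<theta>" "\<theta> \<le> 1" for \<theta>
  proof -
    define E where "E t = W (\<theta> * t + (1 - \<theta>) * (l - t)) - (\<theta> * W t + (1 - \<theta>) * W (l - t))" for t
    have W': "continuous_on UNIV (\<lambda>t. W (f t))" if "continuous_on UNIV f" for f :: "real \<Rightarrow> real"
      by (rule continuous_on_compose2[OF W[of UNIV] that]) simp
    have "continuous_on UNIV E"
      unfolding E_def by (intro continuous_intros W')
    then have "isCont E 0" by (simp add: continuous_on_eq_continuous_at)
    then have "(E \<longlongrightarrow> E 0) (at_right 0)"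
      by (simp add: isCont_def filterlim_at_split)
    \<comment> \<open>t < l/2 puts t strictly to the left of l - t, as \<open>interior\<close>
      requires.\<close>
    moreover have "eventually (\<lambda>t. t \<in> {0<..<l / 2}) (at_right 0)"
      using \<open>0 < l\<close> by (intro eventually_at_right_real) auto
    then have "eventually (\<lambda>t. E t = 0) (at_right 0)"
      by eventually_elim (use interior \<theta> in \<open>auto simp: E_def\<close>)
    then have "(E \<longlongrightarrow> 0) (at_right 0)" by (rule tendsto_eventually)
    ultimately have "E 0 = 0"
      using tendsto_unique[of "at_right (0::real)" E] by simp
    then show ?thesis by (simp add: E_def)
  qed
  \<comment> \<open>The weights 1 - x/l and x/l represent x as a convex combination of 0 and
    l.\<close>
  have "0 \<le> 1 - x / l" "1 - x / l \<le> 1" "(1 - (1 - x / l)) * l = x"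
    using x \<open>0 < l\<close> by (auto simp: field_simps)
  from closed[OF this(1,2)] this(3) have "W x = (1 - x / l) * W 0 + (x / l) * W l"
    by simp
  then show ?thesis using x \<open>0 < l\<close> by (simp add: W_def field_simps)
qed

section \<open>Classical against weak derivatives, and the unit load on one interval\<close>

text \<open>Integration by parts: the boundary terms vanish with \<phi>. If a > b, both integrals
  are over the empty set.\<close>

lemma weak_deriv_if_derivative:
  assumes f: "\<And>x. (f has_real_derivative f' x) (at x)" and f': "continuous_on UNIV f'"
  shows "weak_deriv a b f f'"
  unfolding weak_deriv_def
proof
  fix \<phi> assume \<phi>: "\<phi> \<in> test_functions a b"
  have zero: "\<phi> x = 0" if "x \<notin> {a<..<b}" for x
    using \<phi> that closure_subset[of "{x. \<phi> x \<noteq> 0}"] by (auto simp: test_functions_def)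
  have diff: "(deriv ^^ n) \<phi> field_differentiable at x" for n x
    using \<phi> by (simp add: test_functions_def)
  have cont: "continuous_on A ((deriv ^^ n) \<phi>)" for A n
    by (intro continuous_at_imp_continuous_on ballI field_differentiable_imp_continuous_at diff)
  have \<phi>': "(\<phi> has_real_derivative deriv \<phi> x) (at x)" for x
    using diff[of 0 x] by (simp add: DERIV_deriv_iff_field_differentiable)
  have cont_f: "continuous_on A f" for A
    by (intro continuous_at_imp_continuous_on ballI DERIV_isCont[OF f])
  have cont_f': "continuous_on A f'" for A
    using continuous_on_subset[OF f'] by simp
  show "(LBINT x:{a<..<b}. f x * deriv \<phi> x) = - (LBINT x:{a<..<b}. f' x * \<phi> x)"
  proof (cases "a \<le> b")
    case True
    have "(LBINT x:{a<..<b}. f x * deriv \<phi> x + f' x * \<phi> x) = f b * \<phi> b - f a * \<phi> a"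
    proof (rule LBINT_Ioo_FTC[OF True])
      show "continuous_on {a..b} (\<lambda>x. f x * deriv \<phi> x + f' x * \<phi> x)"
        using cont[of _ 0] cont[of _ 1] by (auto intro!: continuous_intros cont_f cont_f')
      show "((\<lambda>x. f x * \<phi> x) has_real_derivative f x * deriv \<phi> x + f' x * \<phi> x) (at x)" for x
        using DERIV_mult[OF f[of x] \<phi>'[of x]] by (simp add: algebra_simps)
    qed
    moreover have "set_integrable lborel {a<..<b} (\<lambda>x. f x * deriv \<phi> x)"
      "set_integrable lborel {a<..<b} (\<lambda>x. f' x * \<phi> x)"
      using cont[of _ 0] cont[of _ 1]
      by (auto intro!: set_integrable_Ioo_continuous continuous_intros cont_f cont_f')
    ultimately show ?thesis by (simp add: zero)
  qed (simp add: set_lebesgue_integral_def)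
qed

lemma weak_derivD:
  "weak_deriv a b f g \<Longrightarrow> \<phi> \<in> test_functions a b \<Longrightarrow>
   (LBINT x:{a<..<b}. f x * deriv \<phi> x) = - (LBINT x:{a<..<b}. g x * \<phi> x)"
  by (simp add: weak_deriv_def)

text \<open>\<open>g\<close> is only a weak derivative, so both derivatives are moved onto the test
  function. Adding x^2/2 compensates the load, and what remains is affine.\<close>

lemma unit_load_on_interval:
  fixes u :: "real \<Rightarrow> real"
  assumes "0 < l" "continuous_on {0..l} u" "weak_deriv 0 l u g" "weak_deriv 0 l g (\<lambda>x. - 1)"
    and "x \<in> {0..l}"
  shows "u x = u 0 + ((u l - u 0) / l + l / 2) * x - x\<^sup>2 / 2"
proof -
  define w where "w x = u x + x\<^sup>2 / 2" for x
  have "w x = w 0 + (w l - w 0) * x / l"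
  proof (rule affine_if_orthogonal_to_second_derivatives[OF assms(1) _ _ assms(5)])
    show "continuous_on {0..l} w"
      unfolding w_def by (intro continuous_intros assms) auto
    fix \<phi> \<phi>' \<phi>'' c d
    assume smooth: "smooth \<phi>''" and \<phi>: "\<And>x. (\<phi> has_real_derivative \<phi>' x) (at x)"
      "\<And>x. (\<phi>' has_real_derivative \<phi>'' x) (at x)" and cd: "0 < c" "d < l"
      and supp: "\<And>x. x \<notin> {c..d} \<Longrightarrow> \<phi> x = 0"
    have supp': "\<phi>' x = 0" if "x \<notin> {c..d}" for x
      using derivative_zero_outside_support[OF \<phi>(1) supp that] .
    have s': "smooth \<phi>'" and s: "smooth \<phi>"
      using smooth_if_derivative[OF \<phi>(2) smooth] smooth_if_derivative[OF \<phi>(1)] by auto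
    have test: "\<phi> \<in> test_functions 0 l" "\<phi>' \<in> test_functions 0 l"
      by (rule test_functionI[OF s cd supp], simp) (rule test_functionI[OF s' cd supp'], simp)
    have deriv_eq: "deriv \<phi> = \<phi>'" "deriv \<phi>' = \<phi>''"
      by (intro ext DERIV_imp_deriv \<phi>)+
    have int: "set_integrable lborel {0<..<l} (\<lambda>x. f x * \<phi>'' x)" if "continuous_on {0..l} f" for f
      by (rule set_integrable_Ioo_continuous) (intro continuous_intros that smooth_continuous_on smooth)
    \<comment> \<open>The first identity is tested with \<phi>', the second with \<phi>; the two
      minus signs from integration by parts cancel.\<close>
    have u: "(LBINT x:{0<..<l}. u x * \<phi>'' x) = (LBINT x:{0<..<l}. (- 1) * \<phi> x)"
      using weak_derivD[OF assms(3) test(2)] weak_derivD[OF assms(4) test(1)] by (simp only: deriv_eq)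
    have sq: "weak_deriv 0 l (\<lambda>x. x\<^sup>2 / 2) (\<lambda>x. x)"
      by (rule weak_deriv_if_derivative) (auto intro!: derivative_eq_intros)
    have id: "weak_deriv 0 l (\<lambda>x. x) (\<lambda>x. 1)"
      by (rule weak_deriv_if_derivative) auto
    have q: "(LBINT x:{0<..<l}. x\<^sup>2 / 2 * \<phi>'' x) = (LBINT x:{0<..<l}. 1 * \<phi> x)"
      using weak_derivD[OF sq test(2)] weak_derivD[OF id test(1)] by (simp only: deriv_eq)
    have "(LBINT x:{0<..<l}. w x * \<phi>'' x) =
        (LBINT x:{0<..<l}. u x * \<phi>'' x) + (LBINT x:{0<..<l}. x\<^sup>2 / 2 * \<phi>'' x)"
      unfolding w_def distrib_right
      by (rule set_integral_add(2)[OF int[OF assms(2)] int]) (intro continuous_intros, simp)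
    also have "\<dots> = 0"
      unfolding u q by (simp add: set_lebesgue_integral_def)
    finally show "(LBINT x:{0<..<l}. w x * \<phi>'' x) = 0" .
  qed
  then show ?thesis using assms(1) by (simp add: w_def field_simps power2_eq_square)
qed

lemma L2_on_continuous: "continuous_on {a..b} f \<Longrightarrow> f \<in> L2_on a b"
  using set_integrable_Ioo_continuous[of a b f] set_integrable_Ioo_continuous[of a b "\<lambda>x. (f x)\<^sup>2"]
  by (auto simp: L2_on_def set_integrable_def set_borel_measurable_def
      intro: continuous_intros borel_measurable_integrable)

text \<open>Meant for \<open>edge_fun\<close>, which is known to agree with a parabola only on the
  edge, not on all of the reals.\<close>

lemma weak_deriv_cong:
  assumes "\<And>x. x \<in> {a<..<b} \<Longrightarrow> f x = f' x"
  shows "weak_deriv a b f g = weak_deriv a b f' g"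
proof -
  have "(LBINT x:{a<..<b}. f x * deriv \<phi> x) = (LBINT x:{a<..<b}. f' x * deriv \<phi> x)" for \<phi>
    by (rule set_lebesgue_integral_cong) (use assms in auto)
  then show ?thesis by (simp add: weak_deriv_def)
qed


section \<open>The reduced system on the vertices\<close>

text \<open>A trivial kernel makes the determinant nonzero, so a right inverse exists; numbering the
  index set carries this over from matrices.\<close>

lemma square_system_solvable:
  fixes A :: "'v \<Rightarrow> 'v \<Rightarrow> 'a :: field"
  assumes "finite S"
    and inj: "\<And>x. (\<And>v. v \<in> S \<Longrightarrow> (\<Sum>w\<in>S. A v w * x w) = 0) \<Longrightarrow> \<forall>v\<in>S. x v = 0"
  shows "\<exists>x. \<forall>v\<in>S. (\<Sum>w\<in>S. A v w * x w) = b v"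
proof -
  define n where "n = card S"
  obtain f where f: "bij_betw f {0..<n} S"
    using ex_bij_betw_nat_finite[OF assms(1)] n_def by blast
  define g where "g = the_inv_into {0..<n} f"
  have fg: "f (g v) = v" "g v < n" if "v \<in> S" for v
    using f that f_the_inv_into_f_bij_betw[OF f] the_inv_into_into[of f "{0..<n}" v "{0..<n}"]
    by (auto simp: g_def bij_betw_def)
  have gf: "g (f i) = i" "f i \<in> S" if "i < n" for i
    using f that by (auto simp: g_def bij_betw_def the_inv_into_f_f)
  define M where "M = Matrix.mat n n (\<lambda>(i, j). A (f i) (f j))"
  have M: "M \<in> carrier_mat n n" by (simp add: M_def)
  have entry: "vec_index (M *\<^sub>v x) (g v) = (\<Sum>w\<in>S. A v w * vec_index x (g w))"
    if "x \<in> carrier_vec n" "v \<in> S" for x v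
  proof -
    have "vec_index (M *\<^sub>v x) (g v) = (\<Sum>j = 0..<n. A v (f j) * vec_index x j)"
      using that fg by (simp add: M_def scalar_prod_def)
    also have "\<dots> = (\<Sum>j = 0..<n. A v (f j) * vec_index x (g (f j)))"
      by (rule sum.cong) (simp_all add: gf)
    also have "\<dots> = (\<Sum>w\<in>S. A v w * vec_index x (g w))"
      by (rule sum.reindex_bij_betw[OF f])
    finally show ?thesis .
  qed
  have "Determinant.det M \<noteq> 0"
  proof
    assume "Determinant.det M = 0"
    then obtain x where x: "x \<in> carrier_vec n" "x \<noteq> 0\<^sub>v n" "M *\<^sub>v x = 0\<^sub>v n"
      using det_0_iff_vec_prod_zero_field[OF M] by blast
    have "(\<Sum>w\<in>S. A v w * vec_index x (g w)) = 0" if "v \<in> S" for v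
      using entry[OF x(1) that] x(3) fg(2)[OF that] by simp
    then have "\<forall>v\<in>S. vec_index x (g v) = 0" by (rule inj)
    then have "vec_index x i = 0" if "i < n" for i
      using gf[OF that] by metis
    then have "x = 0\<^sub>v n" using x(1) by (intro eq_vecI) auto
    then show False using x(2) by simp
  qed
  \<comment> \<open>\<open>()\<close> fills the extra parameter of the matrix ring. The identity M N
    = 1 makes N y a solution.\<close>
  from det_non_zero_imp_unit[OF M this, of "()"] obtain N where N: "N \<in> carrier_mat n n" "M * N = 1\<^sub>m n"
    by (auto simp: Units_def ring_mat_simps)
  define y where "y = Matrix.vec n (\<lambda>i. b (f i))"
  have y: "y \<in> carrier_vec n" by (simp add: y_def)
  have sol: "M *\<^sub>v (N *\<^sub>v y) = y"
    using assoc_mult_mat_vec[OF M N(1) y] N(2) y by simp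
  have "(\<Sum>w\<in>S. A v w * vec_index (N *\<^sub>v y) (g w)) = b v" if "v \<in> S" for v
    using entry[of "N *\<^sub>v y" v] sol fg[OF that] that mult_mat_vec_carrier[OF N(1) y]
    by (simp add: y_def)
  then show ?thesis by (intro exI[of _ "\<lambda>w. vec_index (N *\<^sub>v y) (g w)"]) blast
qed

section \<open>Vertex operator, load and energy form\<close>

context metric_graph
begin

text \<open>The two sums have the shape of \<open>sum_normal_derivs\<close>, so that vertex
  conditions translate term by term. A loop contributes zero to both.\<close>

definition vertex_operator :: "('v \<Rightarrow> real) \<Rightarrow> ('v \<Rightarrow> real) \<Rightarrow> 'v \<Rightarrow> real" where
  "vertex_operator \<alpha> U v =
     (\<Sum>e\<in>{e \<in> arcs G. tail G e = v}. (U (tail G e) - U (head G e)) / len e) +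
     (\<Sum>e\<in>{e \<in> arcs G. head G e = v}. (U (head G e) - U (tail G e)) / len e) + \<alpha> v * U v"

text \<open>A loop enters both sums and so contributes its full length.\<close>

definition vertex_load :: "'v \<Rightarrow> real" where
  "vertex_load v = (\<Sum>e\<in>{e \<in> arcs G. tail G e = v}. len e / 2) +
     (\<Sum>e\<in>{e \<in> arcs G. head G e = v}. len e / 2)"

text \<open>The solution of -y'' = 1 on the edge with prescribed vertex values, in the form found in
  \<open>unit_load_on_interval\<close>.\<close>

definition edge_parabola :: "('v \<Rightarrow> real) \<Rightarrow> 'e \<Rightarrow> real \<Rightarrow> real" where
  "edge_parabola U e x = U (tail G e) +
     ((U (head G e) - U (tail G e)) / len e + len e / 2) * x - x\<^sup>2 / 2"

text \<open>Every arc has exactly one tail, so the inner sums partition the arcs.\<close>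

lemma sum_verts_tail:
  fixes f :: "'e \<Rightarrow> real"
  shows "(\<Sum>v\<in>verts G. (\<Sum>e\<in>{e \<in> arcs G. tail G e = v}. f e) * X v) = (\<Sum>e\<in>arcs G. f e * X (tail G e))"
proof -
  have "(\<Sum>v\<in>verts G. (\<Sum>e\<in>{e \<in> arcs G. tail G e = v}. f e) * X v) =
      (\<Sum>v\<in>verts G. \<Sum>e\<in>{e \<in> arcs G. tail G e = v}. f e * X (tail G e))"
    by (auto simp: sum_distrib_right intro!: sum.cong)
  also have "\<dots> = (\<Sum>e\<in>arcs G. f e * X (tail G e))"
    by (rule sum.group) auto
  finally show ?thesis .
qed

lemma sum_verts_head:
  fixes f :: "'e \<Rightarrow> real"
  shows "(\<Sum>v\<in>verts G. (\<Sum>e\<in>{e \<in> arcs G. head G e = v}. f e) * X v) = (\<Sum>e\<in>arcs G. f e * X (head G e))"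
proof -
  have "(\<Sum>v\<in>verts G. (\<Sum>e\<in>{e \<in> arcs G. head G e = v}. f e) * X v) =
      (\<Sum>v\<in>verts G. \<Sum>e\<in>{e \<in> arcs G. head G e = v}. f e * X (head G e))"
    by (auto simp: sum_distrib_right intro!: sum.cong)
  also have "\<dots> = (\<Sum>e\<in>arcs G. f e * X (head G e))"
    by (rule sum.group) auto
  finally show ?thesis .
qed

text \<open>Summation by parts: the two ends of an arc combine into a product of differences.
  Symmetry in \<open>U\<close> and \<open>X\<close> is the key to the final comparison; X = U gives
  the energy used for injectivity.\<close>

lemma energy_form:
  "(\<Sum>v\<in>verts G. vertex_operator \<alpha> U v * X v) =
   (\<Sum>e\<in>arcs G. (U (head G e) - U (tail G e)) * (X (head G e) - X (tail G e)) / len e) +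
   (\<Sum>v\<in>verts G. \<alpha> v * U v * X v)"
proof -
  have "(\<Sum>v\<in>verts G. vertex_operator \<alpha> U v * X v) =
    (\<Sum>e\<in>arcs G. (U (tail G e) - U (head G e)) / len e * X (tail G e)) +
    (\<Sum>e\<in>arcs G. (U (head G e) - U (tail G e)) / len e * X (head G e)) +
    (\<Sum>v\<in>verts G. \<alpha> v * U v * X v)"
    by (simp only: vertex_operator_def distrib_right sum.distrib sum_verts_tail sum_verts_head)
  also have "(\<Sum>e\<in>arcs G. (U (tail G e) - U (head G e)) / len e * X (tail G e)) +
    (\<Sum>e\<in>arcs G. (U (head G e) - U (tail G e)) / len e * X (head G e)) =
    (\<Sum>e\<in>arcs G. (U (head G e) - U (tail G e)) * (X (head G e) - X (tail G e)) / len e)"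
    unfolding sum.distrib[symmetric]
    by (rule sum.cong) (auto simp: algebra_simps diff_divide_distrib add_divide_distrib)
  finally show ?thesis .
qed

section \<open>The glued space and its connectedness\<close>

lemma topspace_mg_intervals: "topspace (mg_intervals G len) = (SIGMA e:arcs G. {0..len e})"
  by (simp add: mg_intervals_def o_def)

lemma mg_pointI: "e \<in> arcs G \<Longrightarrow> 0 \<le> x \<Longrightarrow> x \<le> len e \<Longrightarrow> glue G len (e, x) \<in> mg_points G len"
  by (auto simp: mg_points_def topspace_mg_intervals)

lemma glue_endpoints:
  "glue G len (e, 0) = Vertex (tail G e)"
  "e \<in> arcs G \<Longrightarrow> glue G len (e, len e) = Vertex (head G e)"
  using length_pos[of e] by (auto simp: glue_def)

lemma Vertex_mg_point: "v \<in> verts G \<Longrightarrow> Vertex v \<in> mg_points G len"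
proof -
  assume "v \<in> verts G"
  then consider e where "e \<in> arcs G" "v = tail G e" | e where "e \<in> arcs G" "v = head G e"
    using verts_are_endpoints by blast
  then show ?thesis
  proof cases
    case 1
    then show ?thesis using mg_pointI[of e 0] length_pos[of e] by (simp add: glue_endpoints)
  next
    case 2
    then show ?thesis using mg_pointI[of e "len e"] length_pos[of e] by (simp add: glue_endpoints)
  qed
qed

text \<open>Being constant along edges, \<open>U\<close> lifts to a function on the glued space
  whose level sets pull back to unions of whole intervals. These are open, so two distinct values
  would disconnect the space.\<close>

lemma connected_imp_const:
  assumes conn: "mg_connected G len" and edge: "\<And>e. e \<in> arcs G \<Longrightarrow> U (head G e) = U (tail G e)"
    and v: "v \<in> verts G" and w: "w \<in> verts G"
  shows "U v = U w"
proof (rule ccontr)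
  assume neq: "U v \<noteq> U w"
  \<comment> \<open>Taking the tail value inside an edge is a choice; by \<open>edge\<close> the
    head gives the same.\<close>
  define f where "f p = (case p of Vertex v \<Rightarrow> U v | Interior e x \<Rightarrow> U (tail G e))" for p :: "('v, 'e) mg_point"
  have f: "f (glue G len (e, x)) = U (tail G e)" if "e \<in> arcs G" for e x
    using edge[OF that] by (simp add: f_def glue_def)
  \<comment> \<open>A general predicate gives openness of a level set and of its complement.\<close>
  have op: "openin (mg_topology G len) {p \<in> mg_points G len. Q (f p)}" for Q
  proof -
    have pre: "{p \<in> topspace (mg_intervals G len). glue G len p \<in> {p \<in> mg_points G len. Q (f p)}} =
        (SIGMA e:arcs G. if Q (U (tail G e)) then {0..len e} else {})"
      using mg_pointI f by (auto simp: topspace_mg_intervals split: if_splits)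
    have "openin (mg_intervals G len) (SIGMA e:arcs G. if Q (U (tail G e)) then {0..len e} else {})"
      unfolding mg_intervals_def openin_disjoint_union by auto
    then show ?thesis
      by (simp only: openin_mg_topology pre) auto
  qed
  have "connected_space (mg_topology G len)"
    using conn by (simp add: mg_connected_def path_connected_imp_connected_space)
  moreover have "Vertex v \<in> {p \<in> mg_points G len. f p = U v}"
    "Vertex w \<in> {p \<in> mg_points G len. f p \<noteq> U v}"
    using v w neq Vertex_mg_point by (auto simp: f_def)
  moreover have "topspace (mg_topology G len) \<subseteq>
      {p \<in> mg_points G len. f p = U v} \<union> {p \<in> mg_points G len. f p \<noteq> U v}"
    by (auto simp: topspace_mg_topology)
  ultimately show False
    using op[of "\<lambda>y. y = U v"] op[of "\<lambda>y. y \<noteq> U v"] unfolding connected_space_def by blast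
qed

section \<open>Unique solvability of the vertex system, and positivity\<close>

text \<open>The energy is a sum of nonnegative terms, so each one vanishes: the edge terms make
  \<open>U\<close> constant by connectedness, and a vertex of nonzero strength makes the constant
  zero.\<close>

lemma vertex_operator_inj:
  assumes conn: "mg_connected G len"
    and \<alpha>: "\<And>v. v \<in> verts G \<Longrightarrow> 0 \<le> \<alpha> v" "\<exists>v\<in>verts G. \<alpha> v \<noteq> 0"
    and U: "\<And>v. v \<in> verts G \<Longrightarrow> vertex_operator \<alpha> U v = 0"
    and v: "v \<in> verts G"
  shows "U v = 0"
proof -
  let ?E = "\<lambda>e. (U (head G e) - U (tail G e)) * (U (head G e) - U (tail G e)) / len e"
  let ?V = "\<lambda>v. \<alpha> v * U v * U v"
  have "sum ?E (arcs G) + sum ?V (verts G) = 0"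
    using energy_form[of \<alpha> U U] U by simp
  moreover have E: "0 \<le> ?E e" if "e \<in> arcs G" for e
    using length_pos[OF that] by simp
  moreover have V: "0 \<le> ?V v" if "v \<in> verts G" for v
    using \<alpha>(1)[OF that] by (simp add: mult.assoc)
  ultimately have "sum ?E (arcs G) = 0" "sum ?V (verts G) = 0"
    using sum_nonneg[of "arcs G" ?E] sum_nonneg[of "verts G" ?V] by auto
  then have zero: "?E e = 0" "?V w = 0" if "e \<in> arcs G" "w \<in> verts G" for e w
    using sum_nonneg_eq_0_iff[of "arcs G" ?E] sum_nonneg_eq_0_iff[of "verts G" ?V] E V that by auto
  have "U (head G e) = U (tail G e)" if "e \<in> arcs G" for e
    using zero(1)[OF that v] length_pos[OF that] by auto
  moreover obtain w where w: "w \<in> verts G" "\<alpha> w \<noteq> 0" using \<alpha>(2) by blast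
  ultimately have "U v = U w" using connected_imp_const[OF conn, of U v w] v by blast
  moreover have "U w = 0"
  proof -
    \<comment> \<open>\<open>zero\<close> takes an arc together with a vertex, so some arc has to be
      produced.\<close>
    obtain e where "e \<in> arcs G" using w(1) verts_are_endpoints by blast
    then show ?thesis using zero(2)[OF _ w(1)] w(2) by simp
  qed
  ultimately show ?thesis by simp
qed

text \<open>Linearity, applied to the expansion of \<open>U\<close> in indicator functions of
  vertices; this is the matrix form that \<open>square_system_solvable\<close> takes.\<close>

lemma vertex_operator_matrix:
  assumes "v \<in> verts G"
  shows "vertex_operator \<alpha> U v =
    (\<Sum>w\<in>verts G. vertex_operator \<alpha> (\<lambda>z. if z = w then 1 else 0) v * U w)"
proof -
  let ?d = "\<lambda>w z. if z = w then 1 else (0::real)"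
  have U: "U z = (\<Sum>w\<in>verts G. ?d w z * U w)" if "z \<in> verts G" for z
  proof -
    have "(\<Sum>w\<in>verts G. ?d w z * U w) = (\<Sum>w\<in>verts G. if z = w then U w else 0)"
      by (rule sum.cong) auto
    also have "\<dots> = U z" using that by simp
    finally show ?thesis by (rule sym)
  qed
  have diff: "(U y - U z) / l = (\<Sum>w\<in>verts G. (?d w y - ?d w z) / l * U w)"
    if "y \<in> verts G" "z \<in> verts G" for y z l
    by (subst U[OF that(1)], subst U[OF that(2)])
      (simp only: sum_subtractf[symmetric] sum_divide_distrib left_diff_distrib[symmetric]
        times_divide_eq_left)
  \<comment> \<open>Arbitrary \<open>p\<close> and \<open>q\<close> cover the tail sum and the head
    sum alike.\<close>
  have pull: "(\<Sum>e\<in>E. (U (p e) - U (q e)) / len e) =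
      (\<Sum>w\<in>verts G. (\<Sum>e\<in>E. (?d w (p e) - ?d w (q e)) / len e) * U w)"
    if "\<And>e. e \<in> E \<Longrightarrow> p e \<in> verts G \<and> q e \<in> verts G" for E p q
  proof -
    have "(\<Sum>e\<in>E. (U (p e) - U (q e)) / len e) =
        (\<Sum>e\<in>E. \<Sum>w\<in>verts G. (?d w (p e) - ?d w (q e)) / len e * U w)"
      by (rule sum.cong[OF refl], rule diff) (use that in auto)
    also have "\<dots> = (\<Sum>w\<in>verts G. \<Sum>e\<in>E. (?d w (p e) - ?d w (q e)) / len e * U w)"
      by (rule sum.swap)
    finally show ?thesis by (simp only: sum_distrib_right)
  qed
  have "\<alpha> v * U v = (\<Sum>w\<in>verts G. \<alpha> v * ?d w v * U w)"
    by (subst U[OF assms]) (simp only: sum_distrib_left mult.assoc)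
  moreover have "(\<Sum>e\<in>{e \<in> arcs G. tail G e = v}. (U (tail G e) - U (head G e)) / len e) =
    (\<Sum>w\<in>verts G. (\<Sum>e\<in>{e \<in> arcs G. tail G e = v}. (?d w (tail G e) - ?d w (head G e)) / len e) * U w)"
    by (rule pull) auto
  moreover have "(\<Sum>e\<in>{e \<in> arcs G. head G e = v}. (U (head G e) - U (tail G e)) / len e) =
    (\<Sum>w\<in>verts G. (\<Sum>e\<in>{e \<in> arcs G. head G e = v}. (?d w (head G e) - ?d w (tail G e)) / len e) * U w)"
    by (rule pull) auto
  ultimately show ?thesis
    by (simp only: vertex_operator_def distrib_right sum.distrib)
qed

lemma vertex_system_solvable:
  assumes "mg_connected G len"
    and "\<And>v. v \<in> verts G \<Longrightarrow> 0 \<le> \<alpha> v" "\<exists>v\<in>verts G. \<alpha> v \<noteq> 0"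
  shows "\<exists>U. \<forall>v\<in>verts G. vertex_operator \<alpha> U v = b v"
proof -
  have "\<exists>U. \<forall>v\<in>verts G.
      (\<Sum>w\<in>verts G. vertex_operator \<alpha> (\<lambda>z. if z = w then 1 else 0) v * U w) = b v"
  proof (rule square_system_solvable)
    fix U assume "\<And>v. v \<in> verts G \<Longrightarrow>
      (\<Sum>w\<in>verts G. vertex_operator \<alpha> (\<lambda>z. if z = w then 1 else 0) v * U w) = 0"
    then show "\<forall>v\<in>verts G. U v = 0"
      using vertex_operator_inj[OF assms] vertex_operator_matrix by simp
  qed simp
  then show ?thesis using vertex_operator_matrix by simp
qed

lemma vertex_operator_diff:
  "vertex_operator \<alpha> (\<lambda>v. U v - X v) v = vertex_operator \<alpha> U v - vertex_operator \<alpha> X v"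
proof -
  have "(\<Sum>e\<in>E. (U (p e) - X (p e) - (U (q e) - X (q e))) / len e) =
      (\<Sum>e\<in>E. (U (p e) - U (q e)) / len e) - (\<Sum>e\<in>E. (X (p e) - X (q e)) / len e)" for E p q
    by (simp only: sum_subtractf[symmetric]) (rule sum.cong, auto simp: diff_divide_distrib)
  then show ?thesis unfolding vertex_operator_def by (simp only: right_diff_distrib)
qed

lemma vertex_operator_cong:
  "(\<And>v. v \<in> verts G \<Longrightarrow> U v = X v) \<Longrightarrow> v \<in> verts G \<Longrightarrow>
   vertex_operator \<alpha> U v = vertex_operator \<alpha> X v"
  by (auto simp: vertex_operator_def intro!: arg_cong2[of _ _ _ _ "(+)"] sum.cong)

text \<open>Every vertex is an endpoint of an arc of positive length.\<close>

lemma vertex_load_pos: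
  assumes "v \<in> verts G"
  shows "0 < vertex_load v"
proof -
  have nonneg: "0 \<le> (\<Sum>e\<in>{e \<in> arcs G. p e = v}. len e / 2)" for p
    by (rule sum_nonneg) (use length_pos in \<open>auto intro: less_imp_le\<close>)
  have pos: "0 < (\<Sum>e\<in>{e \<in> arcs G. p e = v}. len e / 2)" if "e \<in> arcs G" "p e = v" for e p
    by (rule sum_pos2[of _ e]) (use that length_pos in \<open>auto intro: less_imp_le\<close>)
  from assms consider e where "e \<in> arcs G" "tail G e = v" | e where "e \<in> arcs G" "head G e = v"
    using verts_are_endpoints by blast
  then show ?thesis
  proof cases
    case 1
    then show ?thesis using pos[of e "tail G"] nonneg[of "head G"] by (simp add: vertex_load_def)
  next
    case 2
    then show ?thesis using pos[of e "head G"] nonneg[of "tail G"] by (simp add: vertex_load_def)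
  qed
qed

text \<open>Minimum principle: at a minimum of \<open>U\<close> all edge terms of the operator are nonpositive.\<close>

lemma vertex_solution_pos:
  assumes \<alpha>: "\<And>v. v \<in> verts G \<Longrightarrow> 0 \<le> \<alpha> v"
    and U: "\<And>v. v \<in> verts G \<Longrightarrow> vertex_operator \<alpha> U v = vertex_load v"
    and v: "v \<in> verts G"
  shows "0 < U v"
proof -
  obtain m where m: "m \<in> verts G" "\<And>w. w \<in> verts G \<Longrightarrow> U m \<le> U w"
    using ex_min_if_finite[of "U ` verts G"] v by (auto simp: not_less)
  have "(\<Sum>e\<in>{e \<in> arcs G. tail G e = m}. (U (tail G e) - U (head G e)) / len e) \<le> 0"
    using m(2) length_pos by (auto intro!: sum_nonpos divide_nonpos_pos)
  moreover have "(\<Sum>e\<in>{e \<in> arcs G. head G e = m}. (U (head G e) - U (tail G e)) / len e) \<le> 0"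
    using m(2) length_pos by (auto intro!: sum_nonpos divide_nonpos_pos)
  ultimately have "0 < \<alpha> m * U m"
    using U[OF m(1)] vertex_load_pos[OF m(1)] by (simp add: vertex_operator_def)
  then have "0 < U m" using \<alpha>[OF m(1)] by (simp add: zero_less_mult_iff)
  then show ?thesis using m(2)[OF v] by simp
qed

section \<open>Parabolas on edges and the vertex conditions\<close>

lemma edge_parabola_derivative:
  "(edge_parabola U e has_real_derivative
     (U (head G e) - U (tail G e)) / len e + len e / 2 - x) (at x)"
  unfolding edge_parabola_def by (auto intro!: derivative_eq_intros)

lemma edge_parabola_endpoints:
  "edge_parabola U e 0 = U (tail G e)"
  "e \<in> arcs G \<Longrightarrow> edge_parabola U e (len e) = U (head G e)"
  using length_pos[of e] by (auto simp: edge_parabola_def field_simps power2_eq_square)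

lemma continuous_on_edge_parabola: "continuous_on A (edge_parabola U e)"
  unfolding edge_parabola_def by (intro continuous_intros) auto

lemma weak_derivs_edge_parabola:
  "weak_deriv a b (edge_parabola U e)
     (\<lambda>x. (U (head G e) - U (tail G e)) / len e + len e / 2 - x)"
  "weak_deriv a b (\<lambda>x. (U (head G e) - U (tail G e)) / len e + len e / 2 - x) (\<lambda>x. - 1)"
  by (rule weak_deriv_if_derivative, rule edge_parabola_derivative, intro continuous_intros)
    (rule weak_deriv_if_derivative, auto intro!: derivative_eq_intros)

lemma edge_fun_endpoints:
  "edge_fun G len u e 0 = u (Vertex (tail G e))"
  "e \<in> arcs G \<Longrightarrow> edge_fun G len u e (len e) = u (Vertex (head G e))"
  by (simp_all add: edge_fun_def glue_endpoints)

text \<open>The glued space is a quotient of a disjoint union of intervals, so continuity can be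
  tested on each interval. Agreement at shared vertices is automatic, since \<open>u\<close> is a
  function on the glued space.\<close>

lemma continuous_map_mg_iff:
  "continuous_map (mg_topology G len) euclideanreal u \<longleftrightarrow>
   (\<forall>e\<in>arcs G. continuous_on {0..len e} (edge_fun G len u e))"
proof
  assume u: "continuous_map (mg_topology G len) euclideanreal u"
  show "\<forall>e\<in>arcs G. continuous_on {0..len e} (edge_fun G len u e)"
  proof
    fix e assume "e \<in> arcs G"
    then have "continuous_map (top_of_set {0..len e}) (mg_intervals G len) (\<lambda>x. (e, x))"
      unfolding mg_intervals_def
      using continuous_map_component_injection[of e "arcs G" "\<lambda>e. top_of_set {0..len e}"] by simp
    from continuous_map_compose[OF continuous_map_compose[OF this
          quotient_imp_continuous_map[OF quotient_map_glue]] u]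
    show "continuous_on {0..len e} (edge_fun G len u e)"
      by (simp add: edge_fun_def o_def)
  qed
next
  assume cont: "\<forall>e\<in>arcs G. continuous_on {0..len e} (edge_fun G len u e)"
  have "continuous_map (mg_intervals G len) euclideanreal (u \<circ> glue G len)"
    unfolding continuous_map_def
  proof (intro conjI allI impI)
    fix V :: "real set" assume V: "openin euclideanreal V"
    have eq: "{p \<in> topspace (mg_intervals G len). (u \<circ> glue G len) p \<in> V} =
        (SIGMA e:arcs G. {x \<in> {0..len e}. edge_fun G len u e x \<in> V})"
      by (auto simp: topspace_mg_intervals edge_fun_def)
    have "openin (top_of_set {0..len e}) {x \<in> {0..len e}. edge_fun G len u e x \<in> V}"
      if "e \<in> arcs G" for e
      using cont that V continuous_map_iff_continuous[of "{0..len e}" "edge_fun G len u e"]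
      by (auto simp: continuous_map_def)
    then show "openin (mg_intervals G len) {p \<in> topspace (mg_intervals G len). (u \<circ> glue G len) p \<in> V}"
      unfolding eq by (simp only: mg_intervals_def openin_disjoint_union) blast
  qed simp
  then show "continuous_map (mg_topology G len) euclideanreal u"
    using continuous_compose_quotient_map[OF quotient_map_glue] by blast
qed

text \<open>The slope of the parabola is read off at both ends; the sign in
  \<open>deriv_into_tail\<close> makes each end contribute \<open>- len e / 2\<close>.\<close>

lemma normal_derivs:
  assumes e: "e \<in> arcs G"
    and u: "\<And>x. x \<in> {0..len e} \<Longrightarrow> edge_fun G len u e x = edge_parabola U e x"
  shows "deriv_into_tail G len u e = (U (tail G e) - U (head G e)) / len e - len e / 2"
    and "deriv_into_head G len u e = (U (head G e) - U (tail G e)) / len e - len e / 2"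
proof -
  have l: "0 < len e" using length_pos[OF e] .
  have "vector_derivative (edge_fun G len u e) (at x within {0..len e}) =
      (U (head G e) - U (tail G e)) / len e + len e / 2 - x" if x: "x \<in> {0..len e}" for x
  proof (rule vector_derivative_within_closed_interval[OF l x])
    have "(edge_parabola U e has_vector_derivative
        (U (head G e) - U (tail G e)) / len e + len e / 2 - x) (at x within {0..len e})"
      using has_field_derivative_at_within[OF edge_parabola_derivative]
      by (simp add: has_real_derivative_iff_has_vector_derivative)
    then show "(edge_fun G len u e has_vector_derivative
        (U (head G e) - U (tail G e)) / len e + len e / 2 - x) (at x within {0..len e})"
      by (rule has_vector_derivative_transform[OF x _, rotated]) (use u in simp)
  qed
  from this[of 0] this[of "len e"] l
  show "deriv_into_tail G len u e = (U (tail G e) - U (head G e)) / len e - len e / 2"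
    "deriv_into_head G len u e = (U (head G e) - U (tail G e)) / len e - len e / 2"
    by (auto simp: deriv_into_tail_def deriv_into_head_def diff_divide_distrib)
qed

text \<open>The terms \<open>- len e / 2\<close> of the incident ends add up to the negative of
  \<open>vertex_load\<close>.\<close>

lemma vertex_condition_iff:
  assumes "\<And>e x. e \<in> arcs G \<Longrightarrow> x \<in> {0..len e} \<Longrightarrow> edge_fun G len u e x = edge_parabola U e x"
    and "u (Vertex v) = U v"
  shows "sum_normal_derivs G len u v + \<alpha> v * u (Vertex v) = 0 \<longleftrightarrow>
    vertex_operator \<alpha> U v = vertex_load v"
proof -
  have "sum_normal_derivs G len u v =
    (\<Sum>e\<in>{e \<in> arcs G. tail G e = v}. (U (tail G e) - U (head G e)) / len e - len e / 2) +
    (\<Sum>e\<in>{e \<in> arcs G. head G e = v}. (U (head G e) - U (tail G e)) / len e - len e / 2)"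
    unfolding sum_normal_derivs_def
    by (rule arg_cong2[of _ _ _ _ "(+)"]; rule sum.cong) (use normal_derivs assms(1) in auto)
  then show ?thesis
    using assms(2) by (simp only: sum_subtractf vertex_operator_def vertex_load_def) linarith
qed

section \<open>The torsion problem in terms of vertex values\<close>

text \<open>From left to right this is the regularity result \<open>unit_load_on_interval\<close>;
  from right to left the slope of the parabola is the intermediate weak derivative.\<close>

lemma delta_laplacian_one_iff:
  "delta_laplacian G len \<alpha> u (\<lambda>_. 1) \<longleftrightarrow> u \<in> extensional (mg_points G len) \<and>
     (\<forall>e\<in>arcs G. \<forall>x\<in>{0..len e}. edge_fun G len u e x = edge_parabola (\<lambda>v. u (Vertex v)) e x) \<and>
     (\<forall>v\<in>verts G. vertex_operator \<alpha> (\<lambda>v. u (Vertex v)) v = vertex_load v)"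
    (is "?L \<longleftrightarrow> ?E \<and> ?P \<and> ?V")
proof
  assume L: ?L
  then have dom: "?E" "continuous_map (mg_topology G len) euclideanreal u"
    "\<forall>v\<in>verts G. sum_normal_derivs G len u v + \<alpha> v * u (Vertex v) = 0"
    by (auto simp: delta_laplacian_def delta_domain_def)
  have P: "edge_fun G len u e x = edge_parabola (\<lambda>v. u (Vertex v)) e x"
    if e: "e \<in> arcs G" and x: "x \<in> {0..len e}" for e x
  proof -
    obtain g where "weak_deriv 0 (len e) (edge_fun G len u e) g" "weak_deriv 0 (len e) g (\<lambda>x. - 1)"
      using L e by (auto simp: delta_laplacian_def edge_fun_def)
    moreover have "continuous_on {0..len e} (edge_fun G len u e)"
      using dom(2) e continuous_map_mg_iff by blast
    ultimately have "edge_fun G len u e x = edge_fun G len u e 0 +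
        ((edge_fun G len u e (len e) - edge_fun G len u e 0) / len e + len e / 2) * x - x\<^sup>2 / 2"
      using unit_load_on_interval[OF length_pos[OF e] _ _ _ x] by blast
    then show ?thesis by (simp add: edge_fun_endpoints e edge_parabola_def)
  qed
  moreover have ?V using dom(3) vertex_condition_iff[OF P] by simp
  ultimately show "?E \<and> ?P \<and> ?V" using dom(1) by blast
next
  assume R: "?E \<and> ?P \<and> ?V"
  let ?U = "\<lambda>v. u (Vertex v)"
  have P: "edge_fun G len u e x = edge_parabola ?U e x" if "e \<in> arcs G" "x \<in> {0..len e}" for e x
    using R that by blast
  \<comment> \<open>The slope, serving as witness in \<open>H2_on\<close> and in
    \<open>delta_laplacian\<close> alike.\<close>
  define s where "s e x = (?U (head G e) - ?U (tail G e)) / len e + len e / 2 - x" for e x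
  have cont: "continuous_on {0..len e} (edge_fun G len u e)" if "e \<in> arcs G" for e
    by (subst continuous_on_cong[OF refl P[OF that]]) (simp_all add: continuous_on_edge_parabola)
  have s: "s e \<in> L2_on 0 (len e)" "weak_deriv 0 (len e) (s e) (\<lambda>x. - 1)" for e
    unfolding s_def by (intro L2_on_continuous continuous_intros) (rule weak_derivs_edge_parabola)
  have us: "weak_deriv 0 (len e) (edge_fun G len u e) (s e)" if "e \<in> arcs G" for e
    unfolding s_def using weak_derivs_edge_parabola(1)[of 0 "len e" ?U e] P[OF that]
    by (subst weak_deriv_cong[where f' = "edge_parabola ?U e"]) auto
  \<comment> \<open>Used with c = -1 for the second derivative and with c = 1 for the load.\<close>
  have one: "(\<lambda>x. c) \<in> L2_on 0 (len e)" for c e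
    by (intro L2_on_continuous continuous_intros)
  have "edge_fun G len u e \<in> H2_on 0 (len e)" if "e \<in> arcs G" for e
    unfolding H2_on_def using L2_on_continuous[OF cont[OF that]] s us[OF that] one[of "-1" e] by blast
  moreover have "continuous_map (mg_topology G len) euclideanreal u"
    using cont continuous_map_mg_iff by blast
  moreover have "\<forall>v\<in>verts G. sum_normal_derivs G len u v + \<alpha> v * u (Vertex v) = 0"
    using R vertex_condition_iff[OF P] by simp
  ultimately have "u \<in> delta_domain G len \<alpha>"
    using R by (simp add: delta_domain_def)
  moreover have "edge_fun G len (\<lambda>_. 1) e = (\<lambda>x. 1)" for e
    by (simp add: edge_fun_def)
  ultimately show ?L
    unfolding delta_laplacian_def using one us s by (simp only:) blast
qed

lemma mg_pointsE:
  assumes "p \<in> mg_points G len"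
  obtains e x where "e \<in> arcs G" "x \<in> {0..len e}" "p = glue G len (e, x)"
  using assms by (auto simp: mg_points_def topspace_mg_intervals)

lemma edge_parabola_cong:
  "(\<And>v. v \<in> verts G \<Longrightarrow> U v = X v) \<Longrightarrow> e \<in> arcs G \<Longrightarrow> edge_parabola U e x = edge_parabola X e x"
  by (simp add: edge_parabola_def)

text \<open>Gives meaning to the definite description in \<open>torsion_function\<close>. Existence
  glues the parabolas of a vertex solution; for uniqueness, the difference of the vertex values lies
  in the kernel of the vertex operator.\<close>

lemma ex1_torsion_function:
  assumes conn: "mg_connected G len"
    and \<alpha>: "\<And>v. v \<in> verts G \<Longrightarrow> 0 \<le> \<alpha> v" "\<exists>v\<in>verts G. \<alpha> v \<noteq> 0"
  shows "\<exists>!u. delta_laplacian G len \<alpha> u (\<lambda>_. 1)"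
proof (rule ex_ex1I)
  obtain U where U: "\<And>v. v \<in> verts G \<Longrightarrow> vertex_operator \<alpha> U v = vertex_load v"
    using vertex_system_solvable[OF assms] by blast
  \<comment> \<open>\<open>restrict\<close> provides extensionality. At interval endpoints
    \<open>glue\<close> yields a \<open>Vertex\<close>, where the parabola takes the same
    value.\<close>
  define u where "u = restrict (\<lambda>p. case p of Vertex v \<Rightarrow> U v | Interior e x \<Rightarrow> edge_parabola U e x)
    (mg_points G len)"
  have u_U: "u (Vertex v) = U v" if "v \<in> verts G" for v
    using Vertex_mg_point[OF that] by (simp add: u_def)
  have "edge_fun G len u e x = edge_parabola (\<lambda>v. u (Vertex v)) e x"
    if e: "e \<in> arcs G" and x: "x \<in> {0..len e}" for e x
  proof -
    have "edge_fun G len u e x = edge_parabola U e x"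
      using mg_pointI[OF e, of x] x edge_parabola_endpoints(1)[of U e] edge_parabola_endpoints(2)[OF e, of U]
      by (auto simp: edge_fun_def u_def glue_def)
    also have "\<dots> = edge_parabola (\<lambda>v. u (Vertex v)) e x"
      by (rule edge_parabola_cong) (use u_U e in auto)
    finally show ?thesis .
  qed
  moreover have "vertex_operator \<alpha> (\<lambda>v. u (Vertex v)) v = vertex_load v" if "v \<in> verts G" for v
    using vertex_operator_cong[of "\<lambda>v. u (Vertex v)" U v \<alpha>] u_U U that by simp
  ultimately show "\<exists>u. delta_laplacian G len \<alpha> u (\<lambda>_. 1)"
    unfolding delta_laplacian_one_iff by (intro exI[of _ u]) (auto simp: u_def)
next
  fix u w
  assume "delta_laplacian G len \<alpha> u (\<lambda>_. 1)" "delta_laplacian G len \<alpha> w (\<lambda>_. 1)"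
  note uw = this[unfolded delta_laplacian_one_iff]
  have "u (Vertex v) - w (Vertex v) = 0" if "v \<in> verts G" for v
    by (rule vertex_operator_inj[OF assms, where U = "\<lambda>v. u (Vertex v) - w (Vertex v)"])
      (use uw that vertex_operator_diff in auto)
  then have vertex: "u (Vertex v) = w (Vertex v)" if "v \<in> verts G" for v
    using that by auto
  show "u = w"
  proof (rule extensionalityI)
    fix p assume "p \<in> mg_points G len"
    then obtain e x where e: "e \<in> arcs G" "x \<in> {0..len e}" "p = glue G len (e, x)"
      by (rule mg_pointsE)
    have "edge_fun G len u e x = edge_fun G len w e x"
      using uw e edge_parabola_cong[of "\<lambda>v. u (Vertex v)" "\<lambda>v. w (Vertex v)" e x, OF vertex] by auto
    then show "u p = w p" by (simp add: edge_fun_def e(3))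
  qed (use uw in auto)
qed

section \<open>The rigidity as a function of the vertex values\<close>

text \<open>The trapezoidal rule with its error term, which is exactly \<open>len e ^ 3 / 12\<close>
  for second derivative -1.\<close>

lemma edge_parabola_integral:
  assumes "e \<in> arcs G"
  shows "(LBINT x:{0..len e}. edge_parabola U e x) =
    len e / 2 * U (tail G e) + len e / 2 * U (head G e) + len e ^ 3 / 12"
proof -
  have l: "0 < len e" using length_pos[OF assms] .
  define c where "c = (U (head G e) - U (tail G e)) / len e + len e / 2"
  define F where "F x = U (tail G e) * x + c * x\<^sup>2 / 2 - x ^ 3 / 6" for x
  have F: "(F has_real_derivative edge_parabola U e x) (at x)" for x
    unfolding F_def edge_parabola_def c_def[symmetric]
    by (auto intro!: derivative_eq_intros simp: field_simps)
  have "(LBINT x:{0..len e}. edge_parabola U e x) = F (len e) - F 0"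
    unfolding set_lebesgue_integral_def
    by (rule integral_FTC_atLeastAtMost)
      (use l F in \<open>auto simp: continuous_on_edge_parabola has_field_derivative_at_within
        simp flip: has_real_derivative_iff_has_vector_derivative\<close>)
  also have "\<dots> = len e / 2 * U (tail G e) + len e / 2 * U (head G e) + len e ^ 3 / 12"
    using l by (simp add: F_def c_def field_simps power2_eq_square power3_eq_cube)
  finally show ?thesis .
qed

text \<open>The trapezoidal rule gives half of each length to each endpoint, so regrouping by
  vertices produces \<open>vertex_load\<close>. The cubic term does not depend on \<alpha> and
  cancels in the comparison.\<close>

lemma torsional_rigidity_vertex_values:
  assumes "mg_connected G len"
    and "\<And>v. v \<in> verts G \<Longrightarrow> 0 \<le> \<alpha> v" "\<exists>v\<in>verts G. \<alpha> v \<noteq> 0"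
  obtains U where "\<And>v. v \<in> verts G \<Longrightarrow> vertex_operator \<alpha> U v = vertex_load v"
    "torsional_rigidity G len \<alpha> = (\<Sum>v\<in>verts G. vertex_load v * U v) + (\<Sum>e\<in>arcs G. len e ^ 3 / 12)"
proof -
  define u where "u = torsion_function G len \<alpha>"
  define U where "U v = u (Vertex v)" for v
  have "delta_laplacian G len \<alpha> u (\<lambda>_. 1)"
    unfolding u_def torsion_function_def by (rule theI'[OF ex1_torsion_function[OF assms]])
  then have P: "\<And>e x. e \<in> arcs G \<Longrightarrow> x \<in> {0..len e} \<Longrightarrow> edge_fun G len u e x = edge_parabola U e x"
    and V: "\<And>v. v \<in> verts G \<Longrightarrow> vertex_operator \<alpha> U v = vertex_load v"
    unfolding delta_laplacian_one_iff U_def by auto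
  have "torsional_rigidity G len \<alpha> = (\<Sum>e\<in>arcs G. LBINT x:{0..len e}. edge_parabola U e x)"
    unfolding torsional_rigidity_def mg_integral_def u_def[symmetric]
    by (intro sum.cong refl set_lebesgue_integral_cong) (use P in auto)
  also have "\<dots> = (\<Sum>e\<in>arcs G. len e / 2 * U (tail G e) + len e / 2 * U (head G e) + len e ^ 3 / 12)"
    by (intro sum.cong refl edge_parabola_integral)
  also have "\<dots> = (\<Sum>v\<in>verts G. vertex_load v * U v) + (\<Sum>e\<in>arcs G. len e ^ 3 / 12)"
    by (simp only: vertex_load_def distrib_right sum.distrib sum_verts_tail sum_verts_head)
  finally show thesis using that[of U] V by blast
qed

end

section \<open>Comparison of two strengths\<close>

theorem theorem7p5:
  fixes G :: "('v, 'e) pre_digraph" and len :: "'e \<Rightarrow> real"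
    and \<alpha> \<alpha>' :: "'v \<Rightarrow> real" and v\<^sub>0 :: 'v
  assumes "metric_graph G len"
    and "mg_connected G len"
    and "v\<^sub>0 \<in> verts G"
    and "\<forall>v\<in>verts G. 0 \<le> \<alpha> v"
    and "\<forall>v\<in>verts G. 0 \<le> \<alpha>' v"
    and "\<exists>v\<in>verts G. \<alpha> v \<noteq> 0"
    and "\<exists>v\<in>verts G. \<alpha>' v \<noteq> 0"
    and "\<alpha>' v\<^sub>0 < \<alpha> v\<^sub>0"
    and "\<forall>v\<in>verts G - {v\<^sub>0}. \<alpha>' v = \<alpha> v"
  shows "torsional_rigidity G len \<alpha> < torsional_rigidity G len \<alpha>'"
proof -
  interpret metric_graph G len by fact
  obtain U where U: "\<And>v. v \<in> verts G \<Longrightarrow> vertex_operator \<alpha> U v = vertex_load v"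
    "torsional_rigidity G len \<alpha> = (\<Sum>v\<in>verts G. vertex_load v * U v) + (\<Sum>e\<in>arcs G. len e ^ 3 / 12)"
    using torsional_rigidity_vertex_values[of \<alpha>] assms by blast
  obtain U' where U': "\<And>v. v \<in> verts G \<Longrightarrow> vertex_operator \<alpha>' U' v = vertex_load v"
    "torsional_rigidity G len \<alpha>' = (\<Sum>v\<in>verts G. vertex_load v * U' v) + (\<Sum>e\<in>arcs G. len e ^ 3 / 12)"
    using torsional_rigidity_vertex_values[of \<alpha>'] assms by blast
  let ?B = "\<Sum>e\<in>arcs G. (U (head G e) - U (tail G e)) * (U' (head G e) - U' (tail G e)) / len e"
  \<comment> \<open>Each system is tested with the solution of the other; by symmetry both energies
    share the edge part \<open>?B\<close>.\<close>
  have T: "(\<Sum>v\<in>verts G. vertex_load v * U' v) = ?B + (\<Sum>v\<in>verts G. \<alpha> v * U v * U' v)"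
    using energy_form[of \<alpha> U U'] U(1) by simp
  have T': "(\<Sum>v\<in>verts G. vertex_load v * U v) = ?B + (\<Sum>v\<in>verts G. \<alpha>' v * U' v * U v)"
    using energy_form[of \<alpha>' U' U] U'(1) by (simp add: mult.commute)
  \<comment> \<open>With \<open>?B\<close> cancelled, only the difference of strengths remains, and
    it is supported at \<open>v\<^sub>0\<close>.\<close>
  have "(\<Sum>v\<in>verts G. \<alpha> v * U v * U' v) - (\<Sum>v\<in>verts G. \<alpha>' v * U' v * U v) =
      (\<Sum>v\<in>verts G. (\<alpha> v - \<alpha>' v) * (U v * U' v))"
    by (simp add: sum_subtractf[symmetric] algebra_simps)
  also have "\<dots> = (\<Sum>v\<in>verts G. if v = v\<^sub>0 then (\<alpha> v\<^sub>0 - \<alpha>' v\<^sub>0) * (U v\<^sub>0 * U' v\<^sub>0) else 0)"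
    by (rule sum.cong) (use assms(9) in auto)
  also have "\<dots> = (\<alpha> v\<^sub>0 - \<alpha>' v\<^sub>0) * (U v\<^sub>0 * U' v\<^sub>0)"
    using assms(3) by simp
  also have "0 < \<dots>"
    using vertex_solution_pos[of \<alpha> U v\<^sub>0] vertex_solution_pos[of \<alpha>' U' v\<^sub>0] U(1) U'(1) assms(3,4,5,8)
    by simp
  finally show ?thesis unfolding U(2) U'(2) T T' by linarith
qed

end
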